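(* Let $w=w(x_1,\ldots,x_r)$ be an outer commutator word. Assume that $\mathbf{N}=(N_1,\ldots,N_r)$ is a tuple of normal subgroups of a group $G$ such that the set $w\{\mathbf{N}\}$ is finite. Then the subgroup $w(\mathbf{N})$ is also finite.
   Context: Outer commutator words are defined recursively: every single variable is an outer commutator word, and if $\alpha$ and $\beta$ are outer commutator words involving disjoint sets of variables, then $[\alpha,\beta]$ is an outer commutator word. Writing $w=w(x_1,\ldots,x_r)$ means that $w$ involves exactly the variables $x_1,\ldots,x_r$. For a tuple $\mathbf{S}=(S_1,\ldots,S_r)$ of subsets of $G$, $w\{\mathbf{S}\}$ is the set of all values $w(g_1,\ldots,g_r)$ with $g_i\in S_i$ for all $i$, and $w(\mathbf{S})$ is the subgroup generated by $w\{\mathbf{S}\}$. *)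

theory Defs
  imports "HOL-Algebra.Algebra"
begin

datatype cword = Var nat | Comm cword cword

fun cvars :: "cword \<Rightarrow> nat set" where
  "cvars (Var i) = {i}"
| "cvars (Comm a b) = cvars a \<union> cvars b"

fun outer_commutator_word :: "cword \<Rightarrow> bool" where
  "outer_commutator_word (Var i) = True"
| "outer_commutator_word (Comm a b) =
     (outer_commutator_word a \<and> outer_commutator_word b \<and> cvars a \<inter> cvars b = {})"

definition gcomm :: "('a, 'b) monoid_scheme \<Rightarrow> 'a \<Rightarrow> 'a \<Rightarrow> 'a" where
  "gcomm G x y = inv\<^bsub>G\<^esub> x \<otimes>\<^bsub>G\<^esub> inv\<^bsub>G\<^esub> y \<otimes>\<^bsub>G\<^esub> x \<otimes>\<^bsub>G\<^esub> y"

fun weval :: "('a, 'b) monoid_scheme \<Rightarrow> cword \<Rightarrow> (nat \<Rightarrow> 'a) \<Rightarrow> 'a" where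
  "weval G (Var i) g = g i"
| "weval G (Comm a b) g = gcomm G (weval G a g) (weval G b g)"

definition word_values :: "('a, 'b) monoid_scheme \<Rightarrow> cword \<Rightarrow> (nat \<Rightarrow> 'a set) \<Rightarrow> 'a set" where
  "word_values G w S = {weval G w g | g. \<forall>i \<in> cvars w. g i \<in> S i}"

definition word_subgroup :: "('a, 'b) monoid_scheme \<Rightarrow> cword \<Rightarrow> (nat \<Rightarrow> 'a set) \<Rightarrow> 'a set" where
  "word_subgroup G w S = generate G (word_values G w S)"

end

theory Submission
  imports Defs
begin

text \<open>
  For normal subgroups \<open>M\<^sub>t\<close> the subgroup \<open>w(M)\<close> is an iterated commutator of normal subgroups, and the
  three subgroup lemma gives \<open>[w(M), K] \<subseteq> \<Prod>\<^sub>t w(\<dots>, [M\<^sub>t, K], \<dots>)\<close>. Consequently, modulo the product of the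
  \<open>w(\<dots>, [M\<^sub>t, M\<^sub>i], \<dots>)\<close> with \<open>t \<noteq> i\<close>, powers in the \<open>i\<close>-th argument of \<open>w\<close> become powers of the value.
  If these subgroups are finite and \<open>w\<close> has finitely many values on \<open>M\<close>, then every value has finite order
  and \<open>w(M)\<close> is finite by Dietzmann's lemma.

  For \<open>S\<close> a set of variables put \<open>R = \<Inter>\<^sub>s\<^sub>\<in>\<^sub>S N\<^sub>s\<close>. By downward induction on \<open>S\<close> the subgroup \<open>w(N)\<close> becomes
  finite once \<open>N\<^sub>t\<close> is replaced by \<open>R\<close>, for any \<open>t \<in> S\<close>; singletons \<open>S\<close> give the theorem. When the leaf carries a
  deep enough derived subgroup of \<open>R\<close>, this follows from the case of larger \<open>S\<close>: if \<open>\<alpha>\<close> is a maximal subword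
  with variables in \<open>S\<close> and \<open>\<beta>\<close> is its sibling, then a deep derived subgroup lies in \<open>[A, A]\<close> for
  \<open>A = \<alpha>(R, \<dots>, R)\<close>, and \<open>[A, A, \<beta>(N)] \<subseteq> [\<beta>(N), A, A]\<close> pushes \<open>A \<subseteq> R\<close> into a leaf of \<open>\<beta>\<close>. If \<open>S\<close>
  consists of all variables, it lies in the derived subgroup of \<open>w(N)\<close>, which is finite by Schur's theorem.
  Finally one climbs back from the derived subgroups to \<open>R\<close> by the linearisation above.
\<close>

section \<open>Common exponents and finite images\<close>

lemma finite_cvars: "finite (cvars w)"
  by (induction w) auto

text \<open>The product of the individual exponents works. In the applications \<open>Q g n\<close>
  says that the \<open>n\<close>-th power of \<open>g\<close> is trivial or commutes with a given
  subgroup.\<close>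

lemma common_positive_multiple:
  assumes "finite A" "\<And>g. g \<in> A \<Longrightarrow> \<exists>n>(0::nat). Q g n" "\<And>g n m. Q g n \<Longrightarrow> Q g (n * m)"
  shows "\<exists>n>0. \<forall>g\<in>A. Q g n"
  using assms(1,2)
proof (induction A)
  case (insert a A)
  obtain n where n: "n > 0" "\<forall>g\<in>A. Q g n" using insert by auto
  obtain m where m: "m > 0" "Q a m" using insert.prems by blast
  have "Q a (n * m)" using assms(3)[OF m(2), of n] by (subst mult.commute)
  then have "\<forall>g\<in>insert a A. Q g (n * m)"
    using n(2) assms(3) by blast
  then show ?case using n(1) m(1) by (intro exI[of _ "n * m"]) auto
qed auto

text \<open>The condition makes \<open>g\<close> factor through \<open>f\<close> on
  \<open>A\<close>. Later \<open>f\<close> records two conjugation actions and \<open>g\<close> is a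
  commutator.\<close>

lemma finite_image_factor:
  assumes "finite (f ` A)" "\<And>x y. \<lbrakk>x \<in> A; y \<in> A; f x = f y\<rbrakk> \<Longrightarrow> g x = g y"
  shows "finite (g ` A)"
proof -
  have "g ` A \<subseteq> (\<lambda>z. g (inv_into A f z)) ` (f ` A)"
  proof
    fix y assume "y \<in> g ` A"
    then obtain x where x: "x \<in> A" "y = g x" by blast
    then have "g (inv_into A f (f x)) = g x"
      by (intro assms(2)) (auto simp: inv_into_into f_inv_into_f)
    then show "y \<in> (\<lambda>z. g (inv_into A f z)) ` (f ` A)" using x by (auto intro!: image_eqI)
  qed
  then show ?thesis using assms(1) finite_surj by blast
qed

subsection \<open>Commutators of normal subgroups\<close>

definition comm_sub :: "('a, 'b) monoid_scheme \<Rightarrow> 'a set \<Rightarrow> 'a set \<Rightarrow> 'a set" where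
  "comm_sub G A B = generate G {gcomm G a b | a b. a \<in> A \<and> b \<in> B}"

text \<open>
  The residual of \<open>E\<close> by \<open>S\<close>. Since \<open>[A, B] \<subseteq> E\<close> iff \<open>A \<subseteq> resid G E B\<close>, statements of the
  form \<open>w(M) \<subseteq> E\<close> with arbitrary normal \<open>E\<close> are passed from a word to its subwords by replacing
  \<open>E\<close> with a residual.
\<close>
definition resid :: "('a, 'b) monoid_scheme \<Rightarrow> 'a set \<Rightarrow> 'a set \<Rightarrow> 'a set" where
  "resid G E S = {x \<in> carrier G. \<forall>s\<in>S. gcomm G x s \<in> E}"

text \<open>Kept apart from normality because the values of a word on normal subgroups form a
  conjugation-invariant set that in general is no subgroup.\<close>

definition conj_closed :: "('a, 'b) monoid_scheme \<Rightarrow> 'a set \<Rightarrow> bool" where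
  "conj_closed G S \<longleftrightarrow> S \<subseteq> carrier G \<and>
     (\<forall>g\<in>carrier G. \<forall>s\<in>S. g \<otimes>\<^bsub>G\<^esub> s \<otimes>\<^bsub>G\<^esub> inv\<^bsub>G\<^esub> g \<in> S)"

context group
begin

lemma inv_cancel_left: "\<lbrakk>x \<in> carrier G; y \<in> carrier G\<rbrakk> \<Longrightarrow> inv x \<otimes> (x \<otimes> y) = y"
  by (simp flip: m_assoc)

lemma inv_cancel_left': "\<lbrakk>x \<in> carrier G; y \<in> carrier G\<rbrakk> \<Longrightarrow> x \<otimes> (inv x \<otimes> y) = y"
  by (simp flip: m_assoc)

lemmas group_word_simps = gcomm_def m_assoc inv_mult_group inv_cancel_left inv_cancel_left'

lemma gcomm_closed [simp]: "\<lbrakk>x \<in> carrier G; y \<in> carrier G\<rbrakk> \<Longrightarrow> gcomm G x y \<in> carrier G"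
  by (simp add: gcomm_def)

lemma inv_gcomm: "\<lbrakk>x \<in> carrier G; y \<in> carrier G\<rbrakk> \<Longrightarrow> inv (gcomm G x y) = gcomm G y x"
  by (simp add: group_word_simps)

lemma gcomm_swap_mem:
  assumes "subgroup E G" "x \<in> carrier G" "y \<in> carrier G" "gcomm G x y \<in> E"
  shows "gcomm G y x \<in> E"
  using subgroup.m_inv_closed[OF assms(1,4)] assms(2,3) by (simp add: inv_gcomm)

lemma conj_gcomm:
  assumes "g \<in> carrier G" "x \<in> carrier G" "y \<in> carrier G"
  shows "g \<otimes> gcomm G x y \<otimes> inv g = gcomm G (g \<otimes> x \<otimes> inv g) (g \<otimes> y \<otimes> inv g)"
  using assms by (simp add: group_word_simps)

lemma conj_closedD:
  "\<lbrakk>conj_closed G S; g \<in> carrier G; s \<in> S\<rbrakk> \<Longrightarrow> g \<otimes> s \<otimes> inv g \<in> S"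
  by (simp add: conj_closed_def)

lemma conj_closedD':
  "\<lbrakk>conj_closed G S; g \<in> carrier G; s \<in> S\<rbrakk> \<Longrightarrow> inv g \<otimes> s \<otimes> g \<in> S"
  using conj_closedD[of S "inv g" s] by simp

lemma normal_iff_conj_closed: "E \<lhd> G \<longleftrightarrow> subgroup E G \<and> conj_closed G E"
  using normal_inv_iff subgroup.subset by (fastforce simp: conj_closed_def)

lemma normal_conj_closed: "E \<lhd> G \<Longrightarrow> conj_closed G E"
  by (simp add: normal_iff_conj_closed)

lemma normal_subset_carrier: "E \<lhd> G \<Longrightarrow> E \<subseteq> carrier G"
  using normal_imp_subgroup subgroup.subset by blast

lemma normal_inv_closed: "\<lbrakk>E \<lhd> G; x \<in> E\<rbrakk> \<Longrightarrow> inv x \<in> E"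
  by (rule subgroup.m_inv_closed[OF normal_imp_subgroup])

lemma generate_normal: "conj_closed G S \<Longrightarrow> generate G S \<lhd> G"
  by (rule normal_generateI) (auto simp: conj_closed_def)

lemma conj_closed_gcomm:
  assumes "conj_closed G A" "conj_closed G B"
  shows "conj_closed G {gcomm G a b | a b. a \<in> A \<and> b \<in> B}"
proof -
  have sub: "A \<subseteq> carrier G" "B \<subseteq> carrier G"
    using assms by (auto simp: conj_closed_def)
  show ?thesis
    unfolding conj_closed_def
  proof (intro conjI ballI)
    show "{gcomm G a b | a b. a \<in> A \<and> b \<in> B} \<subseteq> carrier G"
      using sub by (auto simp: subset_iff)
    fix g s assume g: "g \<in> carrier G" and "s \<in> {gcomm G a b | a b. a \<in> A \<and> b \<in> B}"
    then obtain a b where ab: "a \<in> A" "b \<in> B" "s = gcomm G a b" by auto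
    then have "g \<otimes> s \<otimes> inv g = gcomm G (g \<otimes> a \<otimes> inv g) (g \<otimes> b \<otimes> inv g)"
      using conj_gcomm[OF g] sub by (simp add: subset_iff)
    then show "g \<otimes> s \<otimes> inv g \<in> {gcomm G a b | a b. a \<in> A \<and> b \<in> B}"
      using assms ab g conj_closedD by blast
  qed
qed

lemma comm_sub_normal: "\<lbrakk>A \<lhd> G; B \<lhd> G\<rbrakk> \<Longrightarrow> comm_sub G A B \<lhd> G"
  unfolding comm_sub_def
  by (intro generate_normal conj_closed_gcomm normal_conj_closed)

lemma gcomm_in_comm_sub: "\<lbrakk>a \<in> A; b \<in> B\<rbrakk> \<Longrightarrow> gcomm G a b \<in> comm_sub G A B"
  unfolding comm_sub_def by (rule generate.incl) blast

lemma comm_sub_subset_iff: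
  assumes "subgroup E G"
  shows "comm_sub G A B \<subseteq> E \<longleftrightarrow> (\<forall>a\<in>A. \<forall>b\<in>B. gcomm G a b \<in> E)"
proof
  assume "comm_sub G A B \<subseteq> E" then show "\<forall>a\<in>A. \<forall>b\<in>B. gcomm G a b \<in> E"
    using gcomm_in_comm_sub by blast
next
  assume "\<forall>a\<in>A. \<forall>b\<in>B. gcomm G a b \<in> E" then show "comm_sub G A B \<subseteq> E"
    unfolding comm_sub_def by (intro generate_subgroup_incl assms) auto
qed

lemma comm_sub_mono: "\<lbrakk>A \<subseteq> A'; B \<subseteq> B'\<rbrakk> \<Longrightarrow> comm_sub G A B \<subseteq> comm_sub G A' B'"
  unfolding comm_sub_def by (rule mono_generate) blast

lemma comm_sub_commute:
  assumes "A \<lhd> G" "B \<lhd> G"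
  shows "comm_sub G A B = comm_sub G B A"
proof -
  have "comm_sub G A B \<subseteq> comm_sub G B A" if "A \<lhd> G" "B \<lhd> G" for A B
  proof -
    have sg: "subgroup (comm_sub G B A) G"
      using comm_sub_normal that normal_imp_subgroup by blast
    show ?thesis
      unfolding comm_sub_subset_iff[OF sg]
    proof (intro ballI)
      fix a b assume ab: "a \<in> A" "b \<in> B"
      then have "a \<in> carrier G" "b \<in> carrier G"
        using that normal_subset_carrier by auto
      then show "gcomm G a b \<in> comm_sub G B A"
        using gcomm_swap_mem[OF sg] gcomm_in_comm_sub[OF ab(2,1)] by simp
    qed
  qed
  with assms show ?thesis by blast
qed

lemma comm_sub_subset_left:
  assumes "A \<lhd> G" "B \<lhd> G"
  shows "comm_sub G A B \<subseteq> A"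
proof -
  have sg: "subgroup A G" using assms normal_imp_subgroup by blast
  show ?thesis
    unfolding comm_sub_subset_iff[OF sg]
  proof (intro ballI)
    fix a b assume ab: "a \<in> A" "b \<in> B"
    have car: "a \<in> carrier G" "b \<in> carrier G"
      using ab assms normal_subset_carrier by auto
    have "inv a \<otimes> (inv b \<otimes> a \<otimes> b) \<in> A"
      using ab(1) car(2) sg assms(1)
      by (simp add: subgroup.m_inv_closed subgroup.m_closed conj_closedD' normal_conj_closed)
    then show "gcomm G a b \<in> A"
      using car by (simp add: group_word_simps)
  qed
qed

lemma comm_sub_subset_right: "\<lbrakk>A \<lhd> G; B \<lhd> G\<rbrakk> \<Longrightarrow> comm_sub G A B \<subseteq> B"
  using comm_sub_subset_left comm_sub_commute by metis

section \<open>Residuals and the three subgroup lemma\<close>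

lemma gcomm_mult_left:
  assumes "x \<in> carrier G" "y \<in> carrier G" "s \<in> carrier G"
  shows "gcomm G (x \<otimes> y) s = (inv y \<otimes> gcomm G x s \<otimes> y) \<otimes> gcomm G y s"
  using assms by (simp add: group_word_simps)

lemma gcomm_inv_left:
  assumes "x \<in> carrier G" "s \<in> carrier G"
  shows "gcomm G (inv x) s = x \<otimes> inv (gcomm G x s) \<otimes> inv x"
  using assms by (simp add: group_word_simps)

lemma resid_normal:
  assumes E: "E \<lhd> G" and S: "conj_closed G S"
  shows "resid G E S \<lhd> G"
proof -
  have sg: "subgroup E G" and cc: "conj_closed G E"
    using E normal_iff_conj_closed by auto
  have Sc: "s \<in> S \<Longrightarrow> s \<in> carrier G" for s
    using S by (auto simp: conj_closed_def)
  have "subgroup (resid G E S) G"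
  proof (rule subgroupI)
    show "resid G E S \<noteq> {}"
      using Sc subgroup.one_closed[OF sg] by (auto simp: resid_def gcomm_def intro!: exI[of _ \<one>])
  next
    fix x assume "x \<in> resid G E S"
    then show "inv x \<in> resid G E S"
      by (simp add: resid_def gcomm_inv_left Sc conj_closedD[OF cc] subgroup.m_inv_closed[OF sg])
  next
    fix x y assume "x \<in> resid G E S" "y \<in> resid G E S"
    then show "x \<otimes> y \<in> resid G E S"
      by (simp add: resid_def gcomm_mult_left Sc conj_closedD'[OF cc] subgroup.m_closed[OF sg])
  qed (auto simp: resid_def)
  moreover have "conj_closed G (resid G E S)"
    unfolding conj_closed_def
  proof (intro conjI ballI)
    fix g x assume g: "g \<in> carrier G" and x: "x \<in> resid G E S"
    then have xc: "x \<in> carrier G" by (simp add: resid_def)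
    have "gcomm G (g \<otimes> x \<otimes> inv g) s \<in> E" if s: "s \<in> S" for s
    proof -
      \<comment> \<open>The conjugation is shifted to \<open>s\<close>: [g x g^-1, s] is the
        conjugate by \<open>g\<close> of [x, g^-1 s g].\<close>
      have "gcomm G x (inv g \<otimes> s \<otimes> g) \<in> E"
        using x conj_closedD'[OF S g s] by (simp add: resid_def)
      then have "g \<otimes> gcomm G x (inv g \<otimes> s \<otimes> g) \<otimes> inv g \<in> E"
        using conj_closedD[OF cc g] by blast
      then show ?thesis
        using g xc Sc[OF s] by (simp add: group_word_simps)
    qed
    then show "g \<otimes> x \<otimes> inv g \<in> resid G E S"
      using g xc by (simp add: resid_def)
  qed (auto simp: resid_def)
  ultimately show ?thesis by (simp add: normal_iff_conj_closed)
qed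

lemma comm_sub_subset_iff_resid:
  assumes "subgroup E G" "A \<subseteq> carrier G"
  shows "comm_sub G A B \<subseteq> E \<longleftrightarrow> A \<subseteq> resid G E B"
  using assms by (auto simp: comm_sub_subset_iff resid_def)

text \<open>The Hall-Witt identity, solved for one double commutator. The other two appear in the
  form used for the three subgroup lemma.\<close>

lemma hall_witt:
  assumes "a \<in> carrier G" "b \<in> carrier G" "k \<in> carrier G"
  shows "gcomm G (gcomm G a b) k =
    inv b \<otimes> inv ((inv k \<otimes> gcomm G (gcomm G (inv b) (inv k)) a \<otimes> k) \<otimes>
      (inv a \<otimes> gcomm G (gcomm G k (inv a)) (inv b) \<otimes> a)) \<otimes> b"
  using assms by (simp add: group_word_simps)

text \<open>By the Hall-Witt identity [[a, b], k] is built from conjugates of elements of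
  \<open>E\<close>. Since \<open>resid G E K\<close> is a subgroup, it is enough that it contains
  the generators [a, b] of [A, B].\<close>

lemma three_subgroups:
  assumes n: "A \<lhd> G" "B \<lhd> G" "K \<lhd> G" "E \<lhd> G"
    and 1: "comm_sub G (comm_sub G A K) B \<subseteq> E"
    and 2: "comm_sub G (comm_sub G B K) A \<subseteq> E"
  shows "comm_sub G (comm_sub G A B) K \<subseteq> E"
proof -
  have sg: "subgroup E G" and cc: "conj_closed G E"
    using n(4) normal_iff_conj_closed by auto
  note rs = comm_sub_subset_iff_resid[OF sg normal_subset_carrier]
  have rn: "resid G E K \<lhd> G"
    using n normal_conj_closed resid_normal by blast
  have "gcomm G a b \<in> resid G E K" if ab: "a \<in> A" "b \<in> B" for a b
  proof -
    have abc: "a \<in> carrier G" "b \<in> carrier G"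
      using ab n normal_subset_carrier by auto
    have inva: "inv a \<in> A" and invb: "inv b \<in> B"
      using ab n(1,2) normal_inv_closed by blast+
    have "gcomm G (gcomm G a b) k \<in> E" if k: "k \<in> K" for k
    proof -
      have kc: "k \<in> carrier G" and invk: "inv k \<in> K"
        using k n(3) normal_inv_closed normal_subset_carrier by blast+
      have "gcomm G (gcomm G (inv b) (inv k)) a \<in> E"
        using 2 gcomm_in_comm_sub[OF gcomm_in_comm_sub[OF invb invk] ab(1)] by (rule subsetD)
      moreover have "gcomm G k (inv a) \<in> comm_sub G A K"
        using gcomm_in_comm_sub[OF k inva] comm_sub_commute[OF n(1,3)] by simp
      from subsetD[OF 1 gcomm_in_comm_sub[OF this invb]]
      have "gcomm G (gcomm G k (inv a)) (inv b) \<in> E" .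
      ultimately show ?thesis
        unfolding hall_witt[OF abc kc]
        using abc kc
        by (intro conj_closedD'[OF cc] subgroup.m_inv_closed[OF sg] subgroup.m_closed[OF sg])
    qed
    then show ?thesis using abc by (simp add: resid_def)
  qed
  then have "comm_sub G A B \<subseteq> resid G E K"
    using comm_sub_subset_iff normal_imp_subgroup rn by blast
  then show ?thesis
    using rs[OF comm_sub_normal[OF n(1,2)]] by blast
qed

end

subsection \<open>Outer commutator words on tuples of normal subgroups\<close>

text \<open>The iterated commutator subgroup along the tree of the word, a form suited to induction.
  For outer commutator words on normal subgroups \<open>wsub_eq_generate\<close> identifies it with
  the subgroup generated by the values.\<close>

fun wsub :: "('a, 'b) monoid_scheme \<Rightarrow> cword \<Rightarrow> (nat \<Rightarrow> 'a set) \<Rightarrow> 'a set" where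
  "wsub G (Var i) M = M i"
| "wsub G (Comm a b) M = comm_sub G (wsub G a M) (wsub G b M)"

context group
begin

lemma wsub_normal: "(\<And>t. t \<in> cvars w \<Longrightarrow> M t \<lhd> G) \<Longrightarrow> wsub G w M \<lhd> G"
  by (induction w) (auto intro: comm_sub_normal)

lemma wsub_mono: "(\<And>t. t \<in> cvars w \<Longrightarrow> M t \<subseteq> M' t) \<Longrightarrow> wsub G w M \<subseteq> wsub G w M'"
  by (induction w) (auto intro!: comm_sub_mono del: subsetI)

lemma wsub_cong: "(\<And>t. t \<in> cvars w \<Longrightarrow> M t = M' t) \<Longrightarrow> wsub G w M = wsub G w M'"
  by (induction w) auto

lemma wsub_upd_other: "t \<notin> cvars w \<Longrightarrow> wsub G w (M(t := Y)) = wsub G w M"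
  by (rule wsub_cong) auto

lemma wsub_subset_leaf:
  assumes "\<And>t. t \<in> cvars w \<Longrightarrow> M t \<lhd> G" "i \<in> cvars w"
  shows "wsub G w M \<subseteq> M i"
  using assms
proof (induction w)
  case (Comm a b)
  have n: "wsub G a M \<lhd> G" "wsub G b M \<lhd> G"
    using Comm.prems by (auto intro!: wsub_normal)
  have "wsub G a M \<subseteq> M i \<or> wsub G b M \<subseteq> M i"
    using Comm by auto
  then show ?case
    using comm_sub_subset_left[OF n] comm_sub_subset_right[OF n] by auto
qed simp

section \<open>Word values and the subgroup they generate\<close>

lemma weval_closed [simp]:
  "(\<And>t. t \<in> cvars w \<Longrightarrow> m t \<in> carrier G) \<Longrightarrow> weval G w m \<in> carrier G"
  by (induction w) auto

lemma conj_weval: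
  assumes "g \<in> carrier G" "\<And>t. t \<in> cvars w \<Longrightarrow> m t \<in> carrier G"
  shows "g \<otimes> weval G w m \<otimes> inv g = weval G w (\<lambda>t. g \<otimes> m t \<otimes> inv g)"
  using assms(2) by (induction w) (auto simp: conj_gcomm[OF assms(1)])

lemma word_values_conj_closed:
  assumes "\<And>t. t \<in> cvars w \<Longrightarrow> conj_closed G (M t)"
  shows "conj_closed G (word_values G w M)"
  unfolding conj_closed_def
proof (intro conjI ballI subsetI)
  have car: "m t \<in> carrier G" if "\<forall>t\<in>cvars w. m t \<in> M t" "t \<in> cvars w" for m t
    using that assms by (auto simp: conj_closed_def)
  {
    fix x assume "x \<in> word_values G w M"
    then obtain m where "\<forall>t\<in>cvars w. m t \<in> M t" "x = weval G w m"
      by (auto simp: word_values_def)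
    then show "x \<in> carrier G" using weval_closed[of w m] car by blast
  next
    fix g x assume g: "g \<in> carrier G" and "x \<in> word_values G w M"
    then obtain m where m: "\<forall>t\<in>cvars w. m t \<in> M t" "x = weval G w m"
      by (auto simp: word_values_def)
    then have "g \<otimes> x \<otimes> inv g = weval G w (\<lambda>t. g \<otimes> m t \<otimes> inv g)"
      using conj_weval[OF g, of w m] car by blast
    moreover have "\<forall>t\<in>cvars w. g \<otimes> m t \<otimes> inv g \<in> M t"
      using conj_closedD[OF assms g] m(1) by blast
    ultimately show "g \<otimes> x \<otimes> inv g \<in> word_values G w M"
      unfolding word_values_def by blast
  }
qed

lemma weval_in_wsub: "(\<And>t. t \<in> cvars w \<Longrightarrow> m t \<in> M t) \<Longrightarrow> weval G w m \<in> wsub G w M"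
  by (induction w) (auto intro: gcomm_in_comm_sub)

text \<open>Disjointness of the variables allows the two assignments to be glued into one.\<close>

lemma word_values_Comm:
  assumes "cvars a \<inter> cvars b = {}" "x \<in> word_values G a M" "y \<in> word_values G b M"
  shows "gcomm G x y \<in> word_values G (Comm a b) M"
proof -
  obtain m m' where m: "\<forall>t\<in>cvars a. m t \<in> M t" "x = weval G a m"
    and m': "\<forall>t\<in>cvars b. m' t \<in> M t" "y = weval G b m'"
    using assms by (auto simp: word_values_def)
  have cong: "(\<And>t. t \<in> cvars c \<Longrightarrow> f t = f' t) \<Longrightarrow> weval G c f = weval G c f'"
    for c and f f' :: "nat \<Rightarrow> 'a"
    by (induction c) auto
  define f where "f = (\<lambda>t. if t \<in> cvars a then m t else m' t)"
  have "weval G a f = x" "weval G b f = y"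
    unfolding m(2) m'(2) f_def using assms(1) by (auto intro!: cong)
  moreover have "\<forall>t\<in>cvars (Comm a b). f t \<in> M t"
    using m(1) m'(1) by (auto simp: f_def)
  ultimately show ?thesis
    unfolding word_values_def by (auto intro!: exI[of _ f])
qed

text \<open>The two arguments of the outermost commutator are enlarged from values to subgroups one
  after the other. Each time the induction hypothesis is applied to a residual of \<open>E\<close>,
  so \<open>E\<close> varies.\<close>

lemma wsub_subset_of_word_values:
  assumes "outer_commutator_word w" "\<And>t. t \<in> cvars w \<Longrightarrow> M t \<lhd> G"
    and "E \<lhd> G" "word_values G w M \<subseteq> E"
  shows "wsub G w M \<subseteq> E"
  using assms
proof (induction w arbitrary: E)
  case (Var i)
  have "x \<in> word_values G (Var i) M" if "x \<in> M i" for x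
    using that by (auto simp: word_values_def intro!: exI[of _ "\<lambda>_. x"])
  then show ?case using Var by auto
next
  case (Comm a b)
  have sg: "subgroup E G" using Comm.prems normal_imp_subgroup by blast
  have nM: "\<And>t. t \<in> cvars a \<Longrightarrow> M t \<lhd> G" "\<And>t. t \<in> cvars b \<Longrightarrow> M t \<lhd> G"
    using Comm.prems by auto
  have cca: "conj_closed G (word_values G a M)" and ccb: "conj_closed G (word_values G b M)"
    using nM normal_conj_closed by (auto intro!: word_values_conj_closed)
  have na: "wsub G a M \<lhd> G" and nb: "wsub G b M \<lhd> G"
    using nM by (auto intro!: wsub_normal)
  have "gcomm G x y \<in> E" if "x \<in> word_values G a M" "y \<in> word_values G b M" for x y
    using word_values_Comm[OF _ that] Comm.prems by auto
  then have "gcomm G y x \<in> E" if "x \<in> word_values G a M" "y \<in> word_values G b M" for x y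
    using gcomm_swap_mem[OF sg] cca ccb that by (simp add: conj_closed_def subset_iff)
  then have "word_values G b M \<subseteq> resid G E (word_values G a M)"
    using ccb by (auto simp: resid_def conj_closed_def)
  then have "wsub G b M \<subseteq> resid G E (word_values G a M)"
    using Comm.IH(2)[OF _ nM(2) resid_normal[OF Comm.prems(3) cca]] Comm.prems(1) by simp
  then have "word_values G a M \<subseteq> resid G E (wsub G b M)"
    using gcomm_swap_mem[OF sg] cca normal_subset_carrier[OF nb]
    unfolding resid_def conj_closed_def by blast
  then have "wsub G a M \<subseteq> resid G E (wsub G b M)"
    using Comm.IH(1)[OF _ nM(1) resid_normal[OF Comm.prems(3) normal_conj_closed[OF nb]]]
      Comm.prems(1) by simp
  then show ?case
    using comm_sub_subset_iff_resid[OF sg normal_subset_carrier[OF na]] by simp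
qed

lemma word_values_subset_wsub: "word_values G w M \<subseteq> wsub G w M"
  by (auto simp: word_values_def intro!: weval_in_wsub)

lemma wsub_eq_generate:
  assumes "outer_commutator_word w" "\<And>t. t \<in> cvars w \<Longrightarrow> M t \<lhd> G"
  shows "wsub G w M = generate G (word_values G w M)"
proof
  have "conj_closed G (word_values G w M)"
    using assms(2) by (intro word_values_conj_closed normal_conj_closed) auto
  then show "wsub G w M \<subseteq> generate G (word_values G w M)"
    using assms by (intro wsub_subset_of_word_values generate_normal) (auto intro: generate.incl)
  show "generate G (word_values G w M) \<subseteq> wsub G w M"
    using assms(2) word_values_subset_wsub
    by (intro generate_subgroup_incl normal_imp_subgroup wsub_normal) auto
qed

text \<open>Here \<open>E\<close> stands for any normal subgroup containing all factors w(...,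
  [M_t, K], ...). The three subgroup lemma reduces [[A, B], K] to [[A, K], B] and [[B, K], A], which
  the induction handles with residuals of \<open>E\<close>.\<close>

lemma comm_wsub_subset:
  assumes "outer_commutator_word w" "\<And>t. t \<in> cvars w \<Longrightarrow> M t \<lhd> G" "K \<lhd> G" "E \<lhd> G"
    and "\<And>t. t \<in> cvars w \<Longrightarrow> wsub G w (M(t := comm_sub G (M t) K)) \<subseteq> E"
  shows "comm_sub G (wsub G w M) K \<subseteq> E"
  using assms
proof (induction w arbitrary: E)
  case (Comm a b)
  have sg: "subgroup E G" using Comm.prems normal_imp_subgroup by blast
  have nM: "\<And>t. t \<in> cvars a \<Longrightarrow> M t \<lhd> G" "\<And>t. t \<in> cvars b \<Longrightarrow> M t \<lhd> G"
    using Comm.prems by auto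
  have na: "wsub G a M \<lhd> G" and nb: "wsub G b M \<lhd> G"
    using nM by (auto intro!: wsub_normal)
  have step: "comm_sub G (wsub G c M) K \<subseteq> resid G E (wsub G d M)"
    if c: "outer_commutator_word c" "\<And>t. t \<in> cvars c \<Longrightarrow> M t \<lhd> G"
      and nd: "wsub G d M \<lhd> G"
      and IH: "\<And>E. \<lbrakk>E \<lhd> G; \<And>t. t \<in> cvars c \<Longrightarrow> wsub G c (M(t := comm_sub G (M t) K)) \<subseteq> E\<rbrakk>
         \<Longrightarrow> comm_sub G (wsub G c M) K \<subseteq> E"
      and sub: "\<And>t. t \<in> cvars c \<Longrightarrow>
         comm_sub G (wsub G c (M(t := comm_sub G (M t) K))) (wsub G d M) \<subseteq> E" for c d
  proof (rule IH)
    show "resid G E (wsub G d M) \<lhd> G"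
      using Comm.prems(4) nd resid_normal normal_conj_closed by blast
    fix t assume t: "t \<in> cvars c"
    have "wsub G c (M(t := comm_sub G (M t) K)) \<lhd> G"
      using c(2) Comm.prems(3) by (auto intro!: wsub_normal comm_sub_normal)
    then show "wsub G c (M(t := comm_sub G (M t) K)) \<subseteq> resid G E (wsub G d M)"
      using sub[OF t] comm_sub_subset_iff_resid[OF sg normal_subset_carrier] by blast
  qed
  have disj: "cvars a \<inter> cvars b = {}" using Comm.prems by simp
  have "comm_sub G (wsub G a (M(t := comm_sub G (M t) K))) (wsub G b M) \<subseteq> E"
    if "t \<in> cvars a" for t
  proof -
    have "t \<notin> cvars b" using that disj by blast
    then show ?thesis
      using Comm.prems(5)[of t] that by (simp add: wsub_upd_other del: fun_upd_apply)
  qed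
  then have 1: "comm_sub G (wsub G a M) K \<subseteq> resid G E (wsub G b M)"
    using Comm.prems(1,3) nM
    by (intro step nb Comm.IH(1)) (simp_all del: fun_upd_apply)
  have "comm_sub G (wsub G b (M(t := comm_sub G (M t) K))) (wsub G a M) \<subseteq> E"
    if "t \<in> cvars b" for t
  proof -
    have "wsub G b (M(t := comm_sub G (M t) K)) \<lhd> G"
      using nM(2) Comm.prems(3) that by (auto intro!: wsub_normal comm_sub_normal)
    moreover have "t \<notin> cvars a" using that disj by blast
    ultimately show ?thesis
      using Comm.prems(5)[of t] that comm_sub_commute[OF _ na]
      by (simp add: wsub_upd_other del: fun_upd_apply)
  qed
  then have 2: "comm_sub G (wsub G b M) K \<subseteq> resid G E (wsub G a M)"
    using Comm.prems(1,3) nM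
    by (intro step na Comm.IH(2)) (simp_all del: fun_upd_apply)
  have nn: "comm_sub G (wsub G a M) K \<lhd> G" "comm_sub G (wsub G b M) K \<lhd> G"
    using comm_sub_normal na nb Comm.prems(3) by auto
  show ?case
    using three_subgroups[OF na nb Comm.prems(3,4)] 1 2
      comm_sub_subset_iff_resid[OF sg normal_subset_carrier[OF nn(1)]]
      comm_sub_subset_iff_resid[OF sg normal_subset_carrier[OF nn(2)]] by simp
qed simp

end

subsection \<open>Finiteness criteria of Dietzmann and Schur\<close>

definition lprod :: "('a, 'b) monoid_scheme \<Rightarrow> 'a list \<Rightarrow> 'a" where
  "lprod G xs = foldr (\<otimes>\<^bsub>G\<^esub>) xs \<one>\<^bsub>G\<^esub>"

context group
begin

lemma lprod_simps [simp]: "lprod G [] = \<one>" "lprod G (x # xs) = x \<otimes> lprod G xs"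
  by (auto simp: lprod_def)

lemma lprod_closed [simp]: "set xs \<subseteq> carrier G \<Longrightarrow> lprod G xs \<in> carrier G"
  by (induction xs) auto

lemma lprod_append:
  "\<lbrakk>set xs \<subseteq> carrier G; set ys \<subseteq> carrier G\<rbrakk> \<Longrightarrow> lprod G (xs @ ys) = lprod G xs \<otimes> lprod G ys"
  by (induction xs) (auto simp: m_assoc)

lemma lprod_replicate: "x \<in> carrier G \<Longrightarrow> lprod G (replicate n x) = x [^] n"
  by (induction n) (simp, metis nat_pow_Suc2 lprod_simps(2) replicate_Suc)

text \<open>From x g^k = g^k (g^-k x g^k) a power of \<open>g\<close> moves past a letter
  \<open>x\<close> at the cost of a conjugate of \<open>x\<close>, which is again in
  \<open>\<Gamma>\<close>. The total length is preserved.\<close>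

lemma lprod_collect_power:
  assumes cc: "conj_closed G \<Gamma>" and g: "g \<in> \<Gamma>"
  shows "\<lbrakk>set xs \<subseteq> \<Gamma>; k \<le> count_list xs g\<rbrakk> \<Longrightarrow>
    \<exists>ys. set ys \<subseteq> \<Gamma> \<and> length ys + k = length xs \<and> lprod G xs = g [^] k \<otimes> lprod G ys"
proof (induction xs arbitrary: k)
  case Nil
  then show ?case by simp
next
  case (Cons x xs)
  have car: "\<Gamma> \<subseteq> carrier G" using cc by (simp add: conj_closed_def)
  have gc: "g \<in> carrier G" and xc: "x \<in> carrier G" and sub: "set (x # xs) \<subseteq> carrier G"
    using g car Cons.prems by auto
  show ?case
  proof (cases k)
    case 0
    then show ?thesis using Cons.prems sub by (intro exI[of _ "x # xs"]) auto
  next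
    case (Suc k')
    show ?thesis
    proof (cases "x = g")
      case True
      then obtain ys where "set ys \<subseteq> \<Gamma>" "length ys + k' = length xs"
        "lprod G xs = g [^] k' \<otimes> lprod G ys"
        using Cons.IH[of k'] Cons.prems Suc by auto
      moreover from this have "lprod G ys \<in> carrier G" using car by simp
      moreover have "g [^] k = g \<otimes> g [^] k'"
        using Suc gc nat_pow_Suc2 by simp
      ultimately show ?thesis
        using True Suc gc by (intro exI[of _ ys]) (simp add: m_assoc)
    next
      case False
      then obtain ys where ys: "set ys \<subseteq> \<Gamma>" "length ys + k = length xs"
        "lprod G xs = g [^] k \<otimes> lprod G ys"
        using Cons.IH[of k] Cons.prems by auto
      define z where "z = inv (g [^] k) \<otimes> x \<otimes> g [^] k"
      have "z \<in> \<Gamma>"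
        unfolding z_def using conj_closedD'[OF cc] gc Cons.prems by simp
      moreover have "lprod G ys \<in> carrier G" using ys car by simp
      then have "lprod G (x # xs) = g [^] k \<otimes> lprod G (z # ys)"
        using gc xc by (simp add: ys z_def m_assoc inv_cancel_left')
      ultimately show ?thesis
        using ys by (intro exI[of _ "z # ys"]) auto
    qed
  qed
qed

text \<open>
  This covers both Dietzmann's lemma (\<open>g\<^sup>n = 1\<close>) and Schur's theorem (\<open>g\<^sup>n\<close> central, where
  \<open>g\<^sup>n\<^sup>+\<^sup>1\<close> is a product of \<open>n\<close> commutators).
\<close>
lemma finite_generate_of_power_shortening:
  assumes fin: "finite \<Gamma>" and cc: "conj_closed G \<Gamma>"
    and inv: "\<And>g. g \<in> \<Gamma> \<Longrightarrow> inv g \<in> \<Gamma>"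
    and short: "\<And>g. g \<in> \<Gamma> \<Longrightarrow> \<exists>ys. set ys \<subseteq> \<Gamma> \<and> length ys \<le> n \<and> lprod G ys = g [^] Suc n"
  shows "finite (generate G \<Gamma>)"
proof -
  have car: "\<Gamma> \<subseteq> carrier G" using cc by (simp add: conj_closed_def)
  have bound: "\<exists>ys. set ys \<subseteq> \<Gamma> \<and> length ys \<le> card \<Gamma> * n \<and> lprod G ys = lprod G xs"
    if "set xs \<subseteq> \<Gamma>" for xs
    using that
  proof (induction xs rule: length_induct)
    case (1 xs)
    show ?case
    proof (cases "length xs \<le> card \<Gamma> * n")
      case True
      then show ?thesis using 1 by blast
    next
      case False
      \<comment> \<open>Pigeonhole: more than \<open>card \<Gamma> * n\<close> letters force one
        letter to occur \<open>n + 1\<close> times, and that power can be shortened.\<close>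
      have "\<exists>g\<in>\<Gamma>. Suc n \<le> count_list xs g"
      proof (rule ccontr)
        assume "\<not> ?thesis"
        then have "sum (count_list xs) \<Gamma> \<le> of_nat (card \<Gamma>) * n"
          by (intro sum_bounded_above) (auto simp: not_less_eq_eq)
        then show False
          using False sum_count_set[OF "1.prems" fin] by simp
      qed
      then obtain g where g: "g \<in> \<Gamma>" "Suc n \<le> count_list xs g" by blast
      obtain ys where ys: "set ys \<subseteq> \<Gamma>" "length ys + Suc n = length xs"
        "lprod G xs = g [^] Suc n \<otimes> lprod G ys"
        using lprod_collect_power[OF cc g(1) "1.prems" g(2)] by blast
      obtain zs where zs: "set zs \<subseteq> \<Gamma>" "length zs \<le> n" "lprod G zs = g [^] Suc n"
        using short[OF g(1)] by blast
      have "lprod G (zs @ ys) = lprod G xs"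
        using lprod_append[of zs ys] ys zs car by auto
      moreover have "length (zs @ ys) < length xs" "set (zs @ ys) \<subseteq> \<Gamma>"
        using ys zs by auto
      ultimately show ?thesis
        using "1.IH" by metis
    qed
  qed
  define L where "L = {ys. set ys \<subseteq> \<Gamma> \<and> length ys \<le> card \<Gamma> * n}"
  have "\<exists>xs. set xs \<subseteq> \<Gamma> \<and> x = lprod G xs" if "x \<in> generate G \<Gamma>" for x
    using that
  proof induction
    case one
    then show ?case by (intro exI[of _ "[]"]) auto
  next
    case (incl h)
    then show ?case using car by (intro exI[of _ "[h]"]) auto
  next
    case (inv h)
    then show ?case using car assms(3)[OF inv] by (intro exI[of _ "[inv h]"]) auto
  next
    case (eng h1 h2)
    then obtain xs ys where "set xs \<subseteq> \<Gamma>" "h1 = lprod G xs" "set ys \<subseteq> \<Gamma>" "h2 = lprod G ys"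
      by blast
    then show ?case using car lprod_append[of xs ys] by (intro exI[of _ "xs @ ys"]) auto
  qed
  then have "x \<in> lprod G ` L" if "x \<in> generate G \<Gamma>" for x
    using bound that unfolding L_def by (metis (mono_tags, lifting) image_eqI mem_Collect_eq)
  then have "generate G \<Gamma> \<subseteq> lprod G ` L" by blast
  moreover have "finite L"
    unfolding L_def using finite_lists_length_le[OF fin] by blast
  ultimately show ?thesis
    using finite_surj by blast
qed

text \<open>Dietzmann's lemma. Inverses are adjoined to \<open>\<Gamma>\<close>; with a common
  exponent \<open>n > 0\<close> the power \<open>n + 1\<close> of \<open>g\<close> is
  \<open>g\<close>, a product of one letter.\<close>

lemma finite_generate_torsion:
  assumes fin: "finite \<Gamma>" and cc: "conj_closed G \<Gamma>"
    and tors: "\<And>g. g \<in> \<Gamma> \<Longrightarrow> \<exists>n>(0::nat). g [^] n = \<one>"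
  shows "finite (generate G \<Gamma>)"
proof -
  have car: "\<Gamma> \<subseteq> carrier G" using cc by (simp add: conj_closed_def)
  define \<Delta> where "\<Delta> = \<Gamma> \<union> (\<lambda>g. inv g) ` \<Gamma>"
  have \<Delta>c: "\<Delta> \<subseteq> carrier G" using car by (auto simp: \<Delta>_def)
  have "\<exists>n>(0::nat). \<forall>g\<in>\<Delta>. g \<in> carrier G \<and> g [^] n = \<one>"
  proof (rule common_positive_multiple)
    fix g assume g: "g \<in> \<Delta>"
    then obtain h where "h \<in> \<Gamma>" "g = h \<or> g = inv h" by (auto simp: \<Delta>_def)
    moreover from this obtain n :: nat where "n > 0" "h [^] n = \<one>" using tors by blast
    ultimately have "g \<in> carrier G \<and> g [^] n = \<one>"
      using car by (auto simp: subset_iff nat_pow_inv)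
    then show "\<exists>n>(0::nat). g \<in> carrier G \<and> g [^] n = \<one>"
      using \<open>n > 0\<close> by blast
  next
    fix g and n m :: nat assume "g \<in> carrier G \<and> g [^] n = \<one>"
    then show "g \<in> carrier G \<and> g [^] (n * m) = \<one>" by (simp flip: nat_pow_pow)
  qed (simp add: \<Delta>_def fin)
  then obtain n :: nat where n: "n > 0" "\<And>g. g \<in> \<Delta> \<Longrightarrow> g [^] n = \<one>" by blast
  have "finite (generate G \<Delta>)"
  proof (rule finite_generate_of_power_shortening[where n = n])
    show "conj_closed G \<Delta>"
      unfolding conj_closed_def
    proof (intro conjI ballI \<Delta>c)
      fix g s assume g: "g \<in> carrier G" and s: "s \<in> \<Delta>"
      then obtain h where h: "h \<in> \<Gamma>" "s = h \<or> s = inv h" by (auto simp: \<Delta>_def)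
      have "g \<otimes> inv h \<otimes> inv g = inv (g \<otimes> h \<otimes> inv g)"
        using g h car by (auto simp: group_word_simps)
      then show "g \<otimes> s \<otimes> inv g \<in> \<Delta>"
        using conj_closedD[OF cc g h(1)] h(2) by (auto simp: \<Delta>_def)
    qed
    fix g assume g: "g \<in> \<Delta>"
    then show "inv g \<in> \<Delta>" using car by (auto simp: \<Delta>_def)
    show "\<exists>ys. set ys \<subseteq> \<Delta> \<and> length ys \<le> n \<and> lprod G ys = g [^] Suc n"
      using g n \<Delta>c by (intro exI[of _ "[g]"]) auto
  qed (simp add: \<Delta>_def fin)
  then show ?thesis
    using mono_generate[of \<Gamma> \<Delta>] finite_subset by (auto simp: \<Delta>_def)
qed

section \<open>Schur's theorem for groups generated by a finite conjugation-closed set\<close>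

lemma generate_centralized:
  assumes z: "z \<in> carrier G" and W: "W \<subseteq> carrier G"
    and comm: "\<And>x. x \<in> W \<Longrightarrow> z \<otimes> x = x \<otimes> z" and h: "h \<in> generate G W"
  shows "z \<otimes> h = h \<otimes> z"
proof -
  have "subgroup {x \<in> carrier G. z \<otimes> x = x \<otimes> z} G"
  proof (rule subgroupI)
    fix x assume "x \<in> {x \<in> carrier G. z \<otimes> x = x \<otimes> z}"
    then show "inv x \<in> {x \<in> carrier G. z \<otimes> x = x \<otimes> z}"
      using z by simp (metis inv_closed inv_cancel_left m_assoc m_closed r_inv r_one)
  next
    fix x y assume "x \<in> {x \<in> carrier G. z \<otimes> x = x \<otimes> z}" "y \<in> {x \<in> carrier G. z \<otimes> x = x \<otimes> z}"
    then show "x \<otimes> y \<in> {x \<in> carrier G. z \<otimes> x = x \<otimes> z}"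
      using z by simp (metis m_assoc)
  qed (use z in auto)
  then have "generate G W \<subseteq> {x \<in> carrier G. z \<otimes> x = x \<otimes> z}"
    using W comm by (intro generate_subgroup_incl) auto
  then show ?thesis using h by auto
qed

text \<open>Put g = [a, b]. As g^(n+1) commutes with \<open>a\<close>, the power g^(n+2) equals a^-1
  g^(n+1) a g, and the last factors a^-1 g a g of this product form [a a, b]. Thus n + 2 commutators
  become n + 1.\<close>

lemma gcomm_power_Suc:
  assumes a: "a \<in> carrier G" and b: "b \<in> carrier G"
    and central: "gcomm G a b [^] Suc n \<otimes> a = a \<otimes> gcomm G a b [^] Suc n"
  shows "gcomm G a b [^] Suc (Suc n) =
    (inv a \<otimes> gcomm G a b \<otimes> a) [^] n \<otimes> gcomm G (a \<otimes> a) b"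
proof -
  define g where "g = gcomm G a b"
  have g: "g \<in> carrier G" using a b by (simp add: g_def)
  have conj: "(inv a \<otimes> g \<otimes> a) [^] n = inv a \<otimes> g [^] n \<otimes> a" for n :: nat
    using a g by (induction n) (simp_all add: m_assoc inv_cancel_left')
  have split: "gcomm G (a \<otimes> a) b = inv a \<otimes> g \<otimes> a \<otimes> g"
    unfolding g_def using a b by (simp add: group_word_simps)
  have "(inv a \<otimes> g \<otimes> a) [^] n \<otimes> gcomm G (a \<otimes> a) b = inv a \<otimes> (g [^] Suc n \<otimes> a) \<otimes> g"
    unfolding conj split using a g by (simp add: m_assoc inv_cancel_left')
  also have "\<dots> = g [^] Suc (Suc n)"
    using central a g by (simp add: g_def[symmetric] inv_cancel_left del: nat_pow_Suc)
  finally show ?thesis by (simp add: g_def)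
qed

text \<open>Instead of a centre of finite index, the proof uses the conjugation action of the
  generated subgroup \<open>H\<close> on the finite set \<open>W\<close>. Elements acting alike
  differ by one that centralizes \<open>H\<close>, so there are finitely many commutators, and each
  has a positive power centralizing \<open>H\<close>.\<close>

lemma finite_commutator_subgroup:
  assumes fin: "finite W" and cc: "conj_closed G W"
  shows "finite (comm_sub G (generate G W) (generate G W))"
proof -
  define H where "H = generate G W"
  \<comment> \<open>The restriction puts \<open>act h\<close> into the finite set
    \<open>W \<rightarrow>\<^sub>E W\<close> for \<open>h\<close> in the group.\<close>
  define act where "act h = (\<lambda>x\<in>W. h \<otimes> x \<otimes> inv h)" for h
  define \<Gamma> where "\<Gamma> = {gcomm G a b | a b. a \<in> H \<and> b \<in> H}"
  have W: "W \<subseteq> carrier G" using cc by (simp add: conj_closed_def)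
  have nH: "H \<lhd> G" unfolding H_def by (rule generate_normal[OF cc])
  have sH: "subgroup H G" and Hc: "\<And>x. x \<in> H \<Longrightarrow> x \<in> carrier G"
    using nH normal_imp_subgroup normal_subset_carrier by auto
  have act_fin: "finite (act ` A)" if "A \<subseteq> carrier G" for A
  proof (rule finite_subset)
    show "act ` A \<subseteq> W \<rightarrow>\<^sub>E W"
      using that conj_closedD[OF cc] by (auto simp: act_def)
    show "finite (W \<rightarrow>\<^sub>E W)" using fin by (rule finite_PiE) (simp add: fin)
  qed
  have act_eq: "inv h' \<otimes> h \<otimes> x = x \<otimes> (inv h' \<otimes> h)"
    if "h \<in> carrier G" "h' \<in> carrier G" "act h = act h'" "x \<in> H" for h h' x
  proof -
    have "inv h' \<otimes> h \<otimes> y = y \<otimes> (inv h' \<otimes> h)" if y: "y \<in> W" for y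
    proof -
      have yc: "y \<in> carrier G" using W y by blast
      have "h \<otimes> y \<otimes> inv h = h' \<otimes> y \<otimes> inv h'"
        using fun_cong[OF \<open>act h = act h'\<close>, of y] y by (simp add: act_def)
      then have "inv h' \<otimes> (h \<otimes> y \<otimes> inv h) \<otimes> h = inv h' \<otimes> (h' \<otimes> y \<otimes> inv h') \<otimes> h" by simp
      then show ?thesis
        using that(1) \<open>h \<in> carrier G\<close> \<open>h' \<in> carrier G\<close> yc
        by (simp add: m_assoc inv_cancel_left)
    qed
    then show ?thesis
      using generate_centralized[OF _ W] that by (simp add: H_def)
  qed
  have ccG: "conj_closed G \<Gamma>"
    unfolding \<Gamma>_def by (intro conj_closed_gcomm normal_conj_closed nH)
  have \<Gamma>H: "\<Gamma> \<subseteq> H"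
    unfolding \<Gamma>_def gcomm_def using sH
    by (auto intro!: subgroup.m_closed subgroup.m_inv_closed)
  have finG: "finite \<Gamma>"
  proof -
    have "finite ((\<lambda>(a, b). (act a, act b)) ` (H \<times> H))"
    proof (rule finite_subset)
      show "(\<lambda>(a, b). (act a, act b)) ` (H \<times> H) \<subseteq> act ` H \<times> act ` H" by auto
      show "finite (act ` H \<times> act ` H)" using act_fin Hc by auto
    qed
    then have "finite ((\<lambda>(a, b). gcomm G a b) ` (H \<times> H))"
    proof (rule finite_image_factor, clarsimp)
      fix a b a' b' assume h: "a \<in> H" "b \<in> H" "a' \<in> H" "b' \<in> H" "act a = act a'" "act b = act b'"
      \<comment> \<open>Both \<open>y\<close> and \<open>z\<close> centralize \<open>H\<close>, so
        they can be removed from the arguments of the commutator in turn.\<close>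
      define y z where "y = inv a' \<otimes> a" and "z = inv b' \<otimes> b"
      have yz: "y \<in> carrier G" "z \<in> carrier G" "a = a' \<otimes> y" "b = b' \<otimes> z"
        using h Hc by (auto simp: y_def z_def inv_cancel_left')
      have zH: "z \<in> H" using h sH by (simp add: z_def subgroup.m_closed subgroup.m_inv_closed)
      have "gcomm G y b = \<one>"
      proof -
        have "y \<otimes> b = b \<otimes> y" unfolding y_def using act_eq[of a a' b] h Hc by simp
        then show ?thesis
          using yz Hc[OF h(2)] by (simp add: gcomm_def m_assoc inv_cancel_left)
      qed
      moreover have "inv y \<otimes> k \<otimes> y = k" if "k \<in> H" for k
      proof -
        have "y \<otimes> k = k \<otimes> y" unfolding y_def using act_eq[of a a' k] h Hc that by simp
        then show ?thesis
          using yz(1) Hc[OF that] by (metis inv_cancel_left inv_closed m_assoc)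
      qed
      moreover have gH: "gcomm G a' b' \<in> H" "gcomm G a' b \<in> H"
        using h \<Gamma>H by (auto simp: \<Gamma>_def)
      ultimately have "gcomm G a b = gcomm G a' b"
        unfolding yz(3) using gcomm_mult_left[of a' y b] yz Hc h by simp
      also have "gcomm G a' b = gcomm G a' b'"
      proof -
        have "z \<otimes> k = k \<otimes> z" if "k \<in> H" for k
          unfolding z_def using act_eq[of b b' k] h Hc that by simp
        then have za: "z \<otimes> a' = a' \<otimes> z" "z \<otimes> gcomm G a' b' = gcomm G a' b' \<otimes> z"
          using h gH by auto
        have "gcomm G a' b = inv a' \<otimes> inv z \<otimes> inv b' \<otimes> (a' \<otimes> b') \<otimes> z"
          unfolding yz(4) using h Hc yz(2) by (simp add: group_word_simps)
        also have "inv a' \<otimes> inv z = inv z \<otimes> inv a'"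
          using za(1) h Hc yz(2) by (metis inv_mult_group)
        also have "inv z \<otimes> inv a' \<otimes> inv b' \<otimes> (a' \<otimes> b') \<otimes> z = inv z \<otimes> (gcomm G a' b' \<otimes> z)"
          using h Hc yz(2) by (simp add: group_word_simps)
        also have "\<dots> = gcomm G a' b'"
          unfolding za(2)[symmetric] using h Hc yz(2) by (simp add: inv_cancel_left)
        finally show ?thesis .
      qed
      finally show "gcomm G a b = gcomm G a' b'" .
    qed
    moreover have "\<Gamma> = (\<lambda>(a, b). gcomm G a b) ` (H \<times> H)" by (auto simp: \<Gamma>_def)
    ultimately show ?thesis by simp
  qed
  have "\<exists>n>(0::nat). \<forall>g\<in>\<Gamma>. g \<in> carrier G \<and> (\<forall>x\<in>H. g [^] n \<otimes> x = x \<otimes> g [^] n)"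
  proof (rule common_positive_multiple[OF finG])
    fix g assume g: "g \<in> \<Gamma>"
    then have gc: "g \<in> carrier G" using \<Gamma>H Hc by blast
    \<comment> \<open>Two distinct powers of \<open>g\<close> act alike, and their quotient
      centralizes \<open>H\<close>.\<close>
    have "finite (range (\<lambda>i::nat. act (g [^] i)))"
      using act_fin[of "range (\<lambda>i::nat. g [^] i)"] gc by (auto simp: image_image)
    then have "\<not> inj (\<lambda>i::nat. act (g [^] i))"
      using finite_imageD infinite_UNIV_nat by blast
    then obtain i j :: nat where ij: "i < j" "act (g [^] i) = act (g [^] j)"
      unfolding inj_def by (metis linorder_neqE_nat)
    have "g [^] j = g [^] i \<otimes> g [^] (j - i)"
      using ij gc by (simp add: nat_pow_mult)
    then have "inv (g [^] i) \<otimes> g [^] j = g [^] (j - i)"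
      using gc by (simp add: inv_cancel_left)
    then have "\<forall>x\<in>H. g [^] (j - i) \<otimes> x = x \<otimes> g [^] (j - i)"
      using act_eq[of "g [^] j" "g [^] i"] ij gc by simp
    then show "\<exists>n>(0::nat). g \<in> carrier G \<and> (\<forall>x\<in>H. g [^] n \<otimes> x = x \<otimes> g [^] n)"
      using ij gc by (intro exI[of _ "j - i"]) auto
  next
    fix g and n m :: nat
    assume "g \<in> carrier G \<and> (\<forall>x\<in>H. g [^] n \<otimes> x = x \<otimes> g [^] n)"
    then have gc: "g \<in> carrier G" and c: "\<And>x. x \<in> H \<Longrightarrow> g [^] n \<otimes> x = x \<otimes> g [^] n" by auto
    have "(g [^] n) [^] m \<otimes> x = x \<otimes> (g [^] n) [^] m" if x: "x \<in> H" for x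
    proof (induction m)
      case (Suc m)
      have "(g [^] n) [^] Suc m \<otimes> x = (g [^] n) [^] m \<otimes> (x \<otimes> g [^] n)"
        using gc Hc[OF x] c[OF x] by (simp add: m_assoc)
      also have "\<dots> = x \<otimes> (g [^] n) [^] Suc m"
        using gc Hc[OF x] Suc by (simp flip: m_assoc)
      finally show ?case .
    qed (use Hc[OF x] in simp)
    then show "g \<in> carrier G \<and> (\<forall>x\<in>H. g [^] (n * m) \<otimes> x = x \<otimes> g [^] (n * m))"
      using gc by (simp add: nat_pow_pow)
  qed
  then obtain n where n: "n > (0::nat)" "\<And>g x. \<lbrakk>g \<in> \<Gamma>; x \<in> H\<rbrakk> \<Longrightarrow> g [^] n \<otimes> x = x \<otimes> g [^] n"
    by blast
  \<comment> \<open>The shift makes \<open>gcomm_power_Suc\<close> at \<open>k\<close> write the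
    power \<open>n + 1\<close> of \<open>g\<close> with \<open>k + 1 = n\<close>
    commutators.\<close>
  obtain k where k: "n = Suc k" using n(1) gr0_implies_Suc by blast
  have "finite (generate G \<Gamma>)"
  proof (rule finite_generate_of_power_shortening[OF finG ccG, where n = n])
    fix g assume g: "g \<in> \<Gamma>"
    then obtain a b where ab: "a \<in> H" "b \<in> H" "g = gcomm G a b" by (auto simp: \<Gamma>_def)
    then show "inv g \<in> \<Gamma>" using inv_gcomm Hc by (auto simp: \<Gamma>_def)
    define z where "z = inv a \<otimes> g \<otimes> a"
    have z: "z \<in> \<Gamma>" unfolding z_def using conj_closedD'[OF ccG] g ab Hc by blast
    have "g [^] Suc n = z [^] k \<otimes> gcomm G (a \<otimes> a) b"
      using gcomm_power_Suc[of a b k] n(2)[OF g ab(1)] ab Hc by (simp add: k z_def del: nat_pow_Suc)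
    moreover have aab: "gcomm G (a \<otimes> a) b \<in> \<Gamma>"
      unfolding \<Gamma>_def using ab subgroup.m_closed[OF sH ab(1,1)] by blast
    have zc: "z \<in> carrier G" "gcomm G (a \<otimes> a) b \<in> carrier G"
      using z aab \<Gamma>H Hc by blast+
    ultimately have "lprod G (replicate k z @ [gcomm G (a \<otimes> a) b]) = g [^] Suc n"
      using lprod_append[of "replicate k z" "[gcomm G (a \<otimes> a) b]"] zc
      by (simp add: lprod_replicate set_replicate_conv_if del: nat_pow_Suc)
    then show "\<exists>ys. set ys \<subseteq> \<Gamma> \<and> length ys \<le> n \<and> lprod G ys = g [^] Suc n"
      using z aab k by (intro exI[of _ "replicate k z @ [gcomm G (a \<otimes> a) b]"])
        (auto simp: set_replicate_conv_if)
  qed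
  then show ?thesis by (simp add: comm_sub_def \<Gamma>_def H_def)
qed

end

subsection \<open>Linearisation in one variable\<close>

lemma (in group_hom) hom_gcomm:
  "\<lbrakk>x \<in> carrier G; y \<in> carrier G\<rbrakk> \<Longrightarrow> h (gcomm G x y) = gcomm H (h x) (h y)"
  by (simp add: gcomm_def)

context group
begin

section \<open>Powers of commutators modulo a normal subgroup\<close>

lemma gcomm_eq_one_iff:
  assumes "x \<in> carrier G" "y \<in> carrier G"
  shows "gcomm G x y = \<one> \<longleftrightarrow> x \<otimes> y = y \<otimes> x"
proof -
  have eq: "x \<otimes> y = y \<otimes> x \<otimes> gcomm G x y"
    using assms by (simp add: group_word_simps)
  show ?thesis
  proof
    assume "gcomm G x y = \<one>"
    then show "x \<otimes> y = y \<otimes> x" using eq assms by simp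
  next
    assume "x \<otimes> y = y \<otimes> x"
    then show "gcomm G x y = \<one>"
      using l_cancel[of "y \<otimes> x" "gcomm G x y" \<one>] assms by (simp flip: eq)
  qed
qed

lemma gcomm_mult_centralizing:
  assumes "e \<in> carrier G" "x \<in> carrier G" "u \<in> carrier G" "e \<otimes> u = u \<otimes> e"
  shows "gcomm G (e \<otimes> x) u = gcomm G x u"
proof -
  have "gcomm G e u = \<one>" using assms gcomm_eq_one_iff by simp
  then show ?thesis using assms gcomm_mult_left[of e x u] by simp
qed

text \<open>In [p^k p, u] = p^-1 [p^k, u] p [p, u] the conjugation is trivial, because powers of
  [p, u] commute with \<open>p\<close>.\<close>

lemma gcomm_power:
  assumes "p \<in> carrier G" "u \<in> carrier G" "gcomm G p u \<otimes> p = p \<otimes> gcomm G p u"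
  shows "gcomm G (p [^] (k::nat)) u = gcomm G p u [^] k"
proof (induction k)
  case 0
  then show ?case using assms by (simp add: gcomm_def)
next
  case (Suc k)
  have "gcomm G p u [^] k \<otimes> p = p \<otimes> gcomm G p u [^] k"
  proof (induction k)
    case (Suc k)
    have "gcomm G p u [^] Suc k \<otimes> p = gcomm G p u [^] k \<otimes> (p \<otimes> gcomm G p u)"
      using assms by (simp add: m_assoc)
    also have "\<dots> = p \<otimes> gcomm G p u [^] Suc k"
      using assms Suc by (simp flip: m_assoc)
    finally show ?case .
  qed (use assms in simp)
  then have "inv p \<otimes> gcomm G p u [^] k \<otimes> p = gcomm G p u [^] k"
    using assms by (simp add: m_assoc inv_cancel_left)
  then show ?case
    using assms gcomm_mult_left[of "p [^] k" p u] Suc by simp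
qed

lemma gcomm_power_mod:
  assumes E: "E \<lhd> G" and car: "p \<in> carrier G" "p' \<in> carrier G" "u \<in> carrier G"
    and eq: "p' \<otimes> inv (p [^] (k::nat)) \<in> resid G E B" and u: "u \<in> B"
    and c: "gcomm G (gcomm G p u) p \<in> E"
  shows "gcomm G p' u \<otimes> inv (gcomm G p u [^] k) \<in> E"
    and "gcomm G u p' \<otimes> inv (gcomm G u p [^] k) \<in> E"
proof -
  define \<phi> where "\<phi> = (\<lambda>x. E #> x)"
  interpret E: normal E G by (rule E)
  interpret Q: group "G Mod E" by (rule E.factorgroup_is_group)
  interpret h: group_hom G "G Mod E" \<phi>
    unfolding \<phi>_def by unfold_locales (rule E.r_coset_hom_Mod)
  have ker: "\<phi> x = \<one>\<^bsub>G Mod E\<^esub> \<longleftrightarrow> x \<in> E" if "x \<in> carrier G" for x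
    unfolding \<phi>_def one_FactGroup using that coset_join1 coset_join2 E.subgroup_axioms E.subset
    by blast
  define e where "e = p' \<otimes> inv (p [^] k)"
  have e: "e \<in> carrier G" "gcomm G e u \<in> E"
    using eq u by (auto simp: e_def resid_def)
  have p': "p' = e \<otimes> p [^] k"
    using car by (simp add: e_def m_assoc)
  have "\<phi> e \<otimes>\<^bsub>G Mod E\<^esub> \<phi> u = \<phi> u \<otimes>\<^bsub>G Mod E\<^esub> \<phi> e"
    using ker[of "gcomm G e u"] e car Q.gcomm_eq_one_iff by (simp add: h.hom_gcomm)
  moreover have comm: "gcomm (G Mod E) (\<phi> p) (\<phi> u) \<otimes>\<^bsub>G Mod E\<^esub> \<phi> p
      = \<phi> p \<otimes>\<^bsub>G Mod E\<^esub> gcomm (G Mod E) (\<phi> p) (\<phi> u)"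
    using ker[of "gcomm G (gcomm G p u) p"] c car Q.gcomm_eq_one_iff by (simp add: h.hom_gcomm)
  ultimately have 1: "gcomm (G Mod E) (\<phi> p') (\<phi> u) = gcomm (G Mod E) (\<phi> p) (\<phi> u) [^]\<^bsub>G Mod E\<^esub> k"
    using e car Q.gcomm_mult_centralizing[of "\<phi> e" "\<phi> p [^]\<^bsub>G Mod E\<^esub> k" "\<phi> u"] Q.gcomm_power
    by (simp add: p' h.hom_nat_pow del: mult_FactGroup)
  then have "\<phi> (gcomm G p' u \<otimes> inv (gcomm G p u [^] k)) = \<one>\<^bsub>G Mod E\<^esub>"
    using car by (simp add: h.hom_gcomm h.hom_nat_pow del: mult_FactGroup one_FactGroup)
  then show "gcomm G p' u \<otimes> inv (gcomm G p u [^] k) \<in> E"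
    by (rule iffD1[OF ker, rotated]) (use car in simp)
  have "gcomm (G Mod E) (\<phi> u) (\<phi> p') = inv\<^bsub>G Mod E\<^esub> (gcomm (G Mod E) (\<phi> p) (\<phi> u) [^]\<^bsub>G Mod E\<^esub> k)"
    unfolding 1[symmetric] by (rule Q.inv_gcomm[symmetric]) (use car in simp_all)
  also have "\<dots> = gcomm (G Mod E) (\<phi> u) (\<phi> p) [^]\<^bsub>G Mod E\<^esub> k"
    using Q.nat_pow_inv[of "gcomm (G Mod E) (\<phi> p) (\<phi> u)" k] Q.inv_gcomm[of "\<phi> p" "\<phi> u"] car
    by simp
  finally have "\<phi> (gcomm G u p' \<otimes> inv (gcomm G u p [^] k)) = \<one>\<^bsub>G Mod E\<^esub>"
    using car by (simp add: h.hom_gcomm h.hom_nat_pow del: mult_FactGroup one_FactGroup)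
  then show "gcomm G u p' \<otimes> inv (gcomm G u p [^] k) \<in> E"
    by (rule iffD1[OF ker, rotated]) (use car in simp)
qed

lemma weval_upd_other: "i \<notin> cvars w \<Longrightarrow> weval G w (m(i := x)) = weval G w m"
  by (induction w) auto

lemma weval_power_mod_step:
  assumes d: "outer_commutator_word d" and i: "i \<in> cvars c" "i \<notin> cvars d"
    and nM: "\<And>t. t \<in> cvars c \<union> cvars d \<Longrightarrow> M t \<lhd> G" and E: "E \<lhd> G"
    and m: "\<And>t. t \<in> cvars c \<union> cvars d \<Longrightarrow> m t \<in> M t"
    and IH: "weval G c (m(i := m i [^] (k::nat))) \<otimes> inv (weval G c m [^] k) \<in> resid G E (wsub G d M)"
    and sub: "\<And>t. t \<in> cvars d \<Longrightarrow>
      comm_sub G (wsub G d (M(t := comm_sub G (M t) (M i)))) (wsub G c M) \<subseteq> E"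
  shows "gcomm G (weval G c (m(i := m i [^] k))) (weval G d (m(i := m i [^] k))) \<otimes>
      inv (gcomm G (weval G c m) (weval G d m) [^] k) \<in> E"
    and "gcomm G (weval G d (m(i := m i [^] k))) (weval G c (m(i := m i [^] k))) \<otimes>
      inv (gcomm G (weval G d m) (weval G c m) [^] k) \<in> E"
proof -
  have sg: "subgroup E G" using E normal_imp_subgroup by blast
  have nA: "wsub G c M \<lhd> G" and nB: "wsub G d M \<lhd> G" and ni: "M i \<lhd> G"
    using nM i by (auto intro!: wsub_normal)
  have mc: "m t \<in> carrier G" if "t \<in> cvars c \<union> cvars d" for t
    using m[OF that] normal_subset_carrier[OF nM[OF that]] by blast
  have p: "weval G c m \<in> wsub G c M" and u: "weval G d m \<in> wsub G d M"
    using m by (auto intro!: weval_in_wsub)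
  have pc: "weval G c m \<in> carrier G" and uc: "weval G d m \<in> carrier G"
    and p'c: "weval G c (m(i := m i [^] k)) \<in> carrier G"
    using mc i by (auto intro!: weval_closed)
  have nr: "resid G E (wsub G c M) \<lhd> G"
    using resid_normal E nA normal_conj_closed by blast
  \<comment> \<open>As the value of \<open>c\<close> lies in \<open>M i\<close>, this inclusion
    covers its commutator with the value of \<open>d\<close>. The outcome is that [p, u] and
    \<open>p\<close> commute modulo \<open>E\<close>, where \<open>p\<close> and \<open>u\<close>
    are the values of \<open>c\<close> and \<open>d\<close>.\<close>
  have "comm_sub G (wsub G d M) (M i) \<subseteq> resid G E (wsub G c M)"
  proof (rule comm_wsub_subset[OF d _ ni nr])
    show "M t \<lhd> G" if "t \<in> cvars d" for t using nM that by blast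
    fix t assume t: "t \<in> cvars d"
    have "wsub G d (M(t := comm_sub G (M t) (M i))) \<lhd> G"
      using nM ni t by (auto intro!: wsub_normal comm_sub_normal)
    then show "wsub G d (M(t := comm_sub G (M t) (M i))) \<subseteq> resid G E (wsub G c M)"
      using sub[OF t] comm_sub_subset_iff_resid[OF sg normal_subset_carrier] by blast
  qed
  moreover have "weval G c m \<in> M i"
    using p wsub_subset_leaf[of c M i] nM i by blast
  ultimately have "gcomm G (weval G d m) (weval G c m) \<in> resid G E (wsub G c M)"
    using gcomm_in_comm_sub[OF u] by blast
  then have "gcomm G (weval G c m) (weval G d m) \<in> resid G E (wsub G c M)"
    using gcomm_swap_mem[OF normal_imp_subgroup[OF nr] uc pc] by blast
  then have "gcomm G (gcomm G (weval G c m) (weval G d m)) (weval G c m) \<in> E"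
    using p by (simp add: resid_def)
  note gcomm_power_mod[OF E pc p'c uc IH u this]
  then show "gcomm G (weval G c (m(i := m i [^] k))) (weval G d (m(i := m i [^] k))) \<otimes>
      inv (gcomm G (weval G c m) (weval G d m) [^] k) \<in> E"
    and "gcomm G (weval G d (m(i := m i [^] k))) (weval G c (m(i := m i [^] k))) \<otimes>
      inv (gcomm G (weval G d m) (weval G c m) [^] k) \<in> E"
    by (simp_all add: weval_upd_other[OF i(2)] del: fun_upd_apply)
qed

text \<open>The induction follows the path to the leaf \<open>i\<close>. Below a commutator the
  claim is used modulo the residual of \<open>E\<close> by the sibling, whose elements commute with
  the sibling modulo \<open>E\<close>.\<close>

lemma weval_power_mod:
  assumes "outer_commutator_word w" "i \<in> cvars w" "\<And>t. t \<in> cvars w \<Longrightarrow> M t \<lhd> G" "E \<lhd> G"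
    and "\<And>t. t \<in> cvars w \<Longrightarrow> m t \<in> M t"
    and "\<And>t. \<lbrakk>t \<in> cvars w; t \<noteq> i\<rbrakk> \<Longrightarrow> wsub G w (M(t := comm_sub G (M t) (M i))) \<subseteq> E"
  shows "weval G w (m(i := m i [^] (k::nat))) \<otimes> inv (weval G w m [^] k) \<in> E"
  using assms
proof (induction w arbitrary: E)
  case (Var j)
  have "m i \<in> carrier G" using Var normal_subset_carrier[of "M i"] by auto
  then show ?case using Var subgroup.one_closed[OF normal_imp_subgroup, of E G] by simp
next
  case (Comm a b)
  have sg: "subgroup E G" using Comm.prems normal_imp_subgroup by blast
  have disj: "cvars a \<inter> cvars b = {}" and o: "outer_commutator_word a" "outer_commutator_word b"
    using Comm.prems by auto
  have ni: "M i \<lhd> G" using Comm.prems by blast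
  define M' where "M' t = M(t := comm_sub G (M t) (M i))" for t
  have na: "wsub G a M \<lhd> G" and nb: "wsub G b M \<lhd> G"
    using Comm.prems by (auto intro!: wsub_normal)
  have na': "wsub G a (M' t) \<lhd> G" if "t \<in> cvars a" for t
    using Comm.prems(3) ni that by (auto simp: M'_def intro!: wsub_normal comm_sub_normal)
  have nb': "wsub G b (M' t) \<lhd> G" if "t \<in> cvars b" for t
    using Comm.prems(3) ni that by (auto simp: M'_def intro!: wsub_normal comm_sub_normal)
  have sub_a: "comm_sub G (wsub G a (M' t)) (wsub G b M) \<subseteq> E" if "t \<in> cvars a" "t \<noteq> i" for t
  proof -
    have "t \<notin> cvars b" using that disj by blast
    then show ?thesis
      using Comm.prems(6)[of t] that by (simp add: M'_def wsub_upd_other del: fun_upd_apply)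
  qed
  have sub_b: "comm_sub G (wsub G b (M' t)) (wsub G a M) \<subseteq> E" if "t \<in> cvars b" "t \<noteq> i" for t
  proof -
    have "t \<notin> cvars a" using that disj by blast
    then show ?thesis
      using Comm.prems(6)[of t] that comm_sub_commute[OF nb' na]
      by (simp add: M'_def wsub_upd_other del: fun_upd_apply)
  qed
  show ?case
  proof (cases "i \<in> cvars a")
    case True
    then have ib: "i \<notin> cvars b" using disj by blast
    have "weval G a (m(i := m i [^] k)) \<otimes> inv (weval G a m [^] k) \<in> resid G E (wsub G b M)"
    proof (rule Comm.IH(1)[OF o(1) True])
      show "resid G E (wsub G b M) \<lhd> G"
        using resid_normal Comm.prems(4) nb normal_conj_closed by blast
      show "wsub G a (M(t := comm_sub G (M t) (M i))) \<subseteq> resid G E (wsub G b M)"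
        if "t \<in> cvars a" "t \<noteq> i" for t
        using sub_a[OF that] comm_sub_subset_iff_resid[OF sg normal_subset_carrier[OF na']] that
        by (simp add: M'_def)
    qed (use Comm.prems in auto)
    then have "gcomm G (weval G a (m(i := m i [^] k))) (weval G b (m(i := m i [^] k))) \<otimes>
      inv (gcomm G (weval G a m) (weval G b m) [^] k) \<in> E"
      using Comm.prems(3,5) sub_b ib
      by (intro weval_power_mod_step(1)[OF o(2) True ib _ Comm.prems(4)]) (auto simp: M'_def)
    then show ?thesis by (simp del: fun_upd_apply)
  next
    case False
    then have ib: "i \<in> cvars b" using Comm.prems(2) by simp
    have "weval G b (m(i := m i [^] k)) \<otimes> inv (weval G b m [^] k) \<in> resid G E (wsub G a M)"
    proof (rule Comm.IH(2)[OF o(2) ib])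
      show "resid G E (wsub G a M) \<lhd> G"
        using resid_normal Comm.prems(4) na normal_conj_closed by blast
      show "wsub G b (M(t := comm_sub G (M t) (M i))) \<subseteq> resid G E (wsub G a M)"
        if "t \<in> cvars b" "t \<noteq> i" for t
        using sub_b[OF that] comm_sub_subset_iff_resid[OF sg normal_subset_carrier[OF nb']] that
        by (simp add: M'_def)
    qed (use Comm.prems in auto)
    then have "gcomm G (weval G a (m(i := m i [^] k))) (weval G b (m(i := m i [^] k))) \<otimes>
      inv (gcomm G (weval G a m) (weval G b m) [^] k) \<in> E"
      using Comm.prems(3,5) sub_a False
      by (intro weval_power_mod_step(2)[OF o(1) ib False _ Comm.prems(4)]) (auto simp: M'_def)
    then show ?thesis by (simp del: fun_upd_apply)
  qed
qed

lemma torsion_of_finite_powers: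
  assumes x: "x \<in> carrier G" and fin: "finite A" and pow: "\<And>k::nat. x [^] k \<in> A"
  shows "\<exists>n>(0::nat). x [^] n = \<one>"
proof -
  have "finite (range (\<lambda>k::nat. x [^] k))"
    using fin pow finite_subset by (metis image_subsetI)
  then have "\<not> inj (\<lambda>k::nat. x [^] k)"
    using finite_imageD infinite_UNIV_nat by blast
  then obtain i j :: nat where ij: "i < j" "x [^] i = x [^] j"
    unfolding inj_def by (metis linorder_neqE_nat)
  have "x [^] i \<otimes> x [^] (j - i) = x [^] i"
    using nat_pow_mult[OF x, of i "j - i"] ij by simp
  then have "x [^] (j - i) = \<one>" using x by simp
  then show ?thesis using ij(1) by (intro exI[of _ "j - i"]) simp
qed

text \<open>Dietzmann's lemma for the union of the \<open>K t\<close>. It collects finitely many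
  finite error subgroups in one finite \<open>E\<close>.\<close>

lemma finite_normal_join:
  assumes "finite I" "\<And>t. t \<in> I \<Longrightarrow> K t \<lhd> G" "\<And>t. t \<in> I \<Longrightarrow> finite (K t)"
  obtains E where "E \<lhd> G" "finite E" "\<And>t. t \<in> I \<Longrightarrow> K t \<subseteq> E"
proof
  have cc: "conj_closed G (\<Union>t\<in>I. K t)"
    using assms(2) normal_conj_closed unfolding conj_closed_def by blast
  show "generate G (\<Union>t\<in>I. K t) \<lhd> G" by (rule generate_normal[OF cc])
  show "finite (generate G (\<Union>t\<in>I. K t))"
  proof (rule finite_generate_torsion[OF _ cc])
    fix g assume "g \<in> (\<Union>t\<in>I. K t)"
    then obtain t where t: "t \<in> I" "g \<in> K t" by blast
    have sg: "subgroup (K t) G" using assms(2)[OF t(1)] normal_imp_subgroup by blast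
    have gc: "g \<in> carrier G" using sg t(2) subgroup.mem_carrier by metis
    have "g [^] (k::nat) \<in> K t" for k
      by (induction k) (simp_all add: subgroup.one_closed[OF sg] subgroup.m_closed[OF sg] t(2))
    then show "\<exists>n>(0::nat). g [^] n = \<one>"
      using torsion_of_finite_powers[OF gc assms(3)[OF t(1)]] by blast
  qed (use assms in blast)
  show "K t \<subseteq> generate G (\<Union>t\<in>I. K t)" if "t \<in> I" for t
    using that by (auto intro: generate.incl)
qed

lemma word_values_mono:
  "(\<And>t. t \<in> cvars w \<Longrightarrow> M t \<subseteq> M' t) \<Longrightarrow> word_values G w M \<subseteq> word_values G w M'"
  unfolding word_values_def by fast

text \<open>With the error subgroups collected in a finite \<open>E\<close>, a power x^k of a value
  is, up to a factor in \<open>E\<close>, the value whose \<open>i\<close>-th argument is raised to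
  the power \<open>k\<close>. So the powers of \<open>x\<close> lie in a finite set and Dietzmann's
  lemma applies.\<close>

lemma finite_wsub_linear:
  assumes o: "outer_commutator_word w" and i: "i \<in> cvars w"
    and nM: "\<And>t. t \<in> cvars w \<Longrightarrow> M t \<lhd> G"
    and fin: "finite (word_values G w M)"
    and sub: "\<And>t. \<lbrakk>t \<in> cvars w; t \<noteq> i\<rbrakk> \<Longrightarrow> finite (wsub G w (M(t := comm_sub G (M t) (M i))))"
  shows "finite (wsub G w M)"
proof -
  have "finite (cvars w - {i})" using finite_cvars by blast
  then obtain E where E: "E \<lhd> G" "finite E"
    and sub': "\<And>t. t \<in> cvars w - {i} \<Longrightarrow> wsub G w (M(t := comm_sub G (M t) (M i))) \<subseteq> E"
  proof (rule finite_normal_join[where K = "\<lambda>t. wsub G w (M(t := comm_sub G (M t) (M i)))"])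
    show "wsub G w (M(t := comm_sub G (M t) (M i))) \<lhd> G" if "t \<in> cvars w - {i}" for t
      using nM i by (auto intro!: wsub_normal comm_sub_normal)
  qed (use sub in auto)
  define A where "A = (\<lambda>(e, y). inv e \<otimes> y) ` (E \<times> word_values G w M)"
  have "finite (generate G (word_values G w M))"
  proof (rule finite_generate_torsion[OF fin])
    show cc: "conj_closed G (word_values G w M)"
      using nM by (intro word_values_conj_closed normal_conj_closed) auto
    fix x assume x: "x \<in> word_values G w M"
    then obtain m where m: "\<And>t. t \<in> cvars w \<Longrightarrow> m t \<in> M t" "x = weval G w m"
      by (auto simp: word_values_def)
    have xc: "x \<in> carrier G" using x cc by (auto simp: conj_closed_def)
    have "x [^] k \<in> A" for k :: nat
    proof -
      define y where "y = weval G w (m(i := m i [^] k))"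
      have "m i [^] k \<in> M i"
        using m(1)[OF i] nM[OF i] normal_imp_subgroup[of "M i" G]
        by (induction k) (auto simp: subgroup.one_closed subgroup.m_closed)
      then have "\<forall>t\<in>cvars w. (m(i := m i [^] k)) t \<in> M t" using m(1) by simp
      then have y: "y \<in> word_values G w M"
        unfolding y_def word_values_def by blast
      then have yc: "y \<in> carrier G" using cc by (auto simp: conj_closed_def)
      have "y \<otimes> inv (x [^] k) \<in> E"
        unfolding y_def m(2) using sub' by (intro weval_power_mod[OF o i nM E(1) m(1)]) auto
      moreover have "x [^] k = inv (y \<otimes> inv (x [^] k)) \<otimes> y"
        using xc yc by (simp add: inv_mult_group m_assoc)
      ultimately show ?thesis
        using y unfolding A_def by (auto intro!: image_eqI[of _ _ "(y \<otimes> inv (x [^] k), y)"])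
    qed
    moreover have "finite A" unfolding A_def using E(2) fin by blast
    ultimately show "\<exists>n>(0::nat). x [^] n = \<one>"
      using torsion_of_finite_powers[OF xc] by blast
  qed
  then show ?thesis using wsub_eq_generate[OF o nM] by simp
qed

end

subsection \<open>Finiteness by induction on the variables\<close>

primrec dser :: "('a, 'b) monoid_scheme \<Rightarrow> nat \<Rightarrow> 'a set \<Rightarrow> 'a set" where
  "dser G 0 R = R"
| "dser G (Suc n) R = comm_sub G (dser G n R) (dser G n R)"

text \<open>
  The role of \<open>R\<close> is played by the intersection of the \<open>N\<^sub>s\<close> with \<open>s \<in> S\<close>. Putting a deep derived
  subgroup of \<open>R\<close> at a leaf in \<open>S\<close> is then controlled by the tuples having \<open>N\<^sub>s \<inter> R\<close> at a leaf \<open>s\<close>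
  outside \<open>S\<close>, although \<open>R\<close> need not be soluble.
\<close>
definition deep_leaf_absorbed ::
  "('a, 'b) monoid_scheme \<Rightarrow> (nat \<Rightarrow> 'a set) \<Rightarrow> nat set \<Rightarrow> 'a set \<Rightarrow> nat \<Rightarrow> cword \<Rightarrow> bool" where
  "deep_leaf_absorbed G N S R D v \<longleftrightarrow>
     (\<forall>E. E \<lhd> G \<longrightarrow> (\<forall>s\<in>cvars v - S. wsub G v (N(s := N s \<inter> R)) \<subseteq> E) \<longrightarrow>
       (\<forall>t\<in>cvars v \<inter> S. wsub G v (N(t := dser G D R)) \<subseteq> E))"

text \<open>The part of \<open>deep_leaf_absorbed\<close> for a commutator of \<open>c\<close> and
  \<open>d\<close> that concerns leaves in \<open>c\<close>. The changed subword always stands on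
  the left, so exchanging \<open>c\<close> and \<open>d\<close> covers the leaves in
  \<open>d\<close>.\<close>

definition deep_leaf_absorbed_side ::
  "('a, 'b) monoid_scheme \<Rightarrow> (nat \<Rightarrow> 'a set) \<Rightarrow> nat set \<Rightarrow> 'a set \<Rightarrow> nat \<Rightarrow> cword \<Rightarrow> cword \<Rightarrow> bool"
  where "deep_leaf_absorbed_side G N S R D c d \<longleftrightarrow>
     (\<forall>E. E \<lhd> G \<longrightarrow>
       (\<forall>s\<in>cvars c - S. comm_sub G (wsub G c (N(s := N s \<inter> R))) (wsub G d N) \<subseteq> E) \<longrightarrow>
       (\<forall>s\<in>cvars d - S. comm_sub G (wsub G d (N(s := N s \<inter> R))) (wsub G c N) \<subseteq> E) \<longrightarrow>
       (\<forall>t\<in>cvars c \<inter> S. comm_sub G (wsub G c (N(t := dser G D R))) (wsub G d N) \<subseteq> E))"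

context group
begin

section \<open>Derived subgroups placed at the leaves\<close>

lemma wsub_upd_subset:
  assumes "\<And>t. t \<in> cvars w \<Longrightarrow> N t \<lhd> G" "t \<in> cvars w" "Y \<lhd> G"
  shows "wsub G w (N(t := Y)) \<subseteq> Y"
proof -
  have "wsub G w (N(t := Y)) \<subseteq> (N(t := Y)) t"
    by (rule wsub_subset_leaf) (use assms in auto)
  then show ?thesis by simp
qed

lemma dser_normal: "R \<lhd> G \<Longrightarrow> dser G n R \<lhd> G"
  by (induction n) (auto intro: comm_sub_normal)

lemma dser_antimono:
  assumes "R \<lhd> G" "m \<le> n"
  shows "dser G n R \<subseteq> dser G m R"
  using assms(2)
proof (induction rule: dec_induct)
  case (step k)
  then show ?case
    using comm_sub_subset_left[OF dser_normal dser_normal, OF assms(1,1), of k k] by simp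
qed simp

lemma dser_subset: "R \<lhd> G \<Longrightarrow> dser G n R \<subseteq> R"
  using dser_antimono[of R 0 n] by simp

lemma dser_add: "dser G (m + n) R = dser G n (dser G m R)"
  by (induction n) auto

text \<open>The depth depends on \<open>w\<close> alone, so the bound also applies to a derived
  subgroup in place of \<open>R\<close>. Each commutator costs one more than its deeper
  side.\<close>

lemma dser_subset_wsub: "\<exists>d. \<forall>R. R \<lhd> G \<longrightarrow> dser G d R \<subseteq> wsub G w (\<lambda>_. R)"
proof (induction w)
  case (Var i)
  show ?case by (rule exI[of _ 0]) simp
next
  case (Comm a b)
  then obtain da db where da: "\<And>R. R \<lhd> G \<Longrightarrow> dser G da R \<subseteq> wsub G a (\<lambda>_. R)"
    and db: "\<And>R. R \<lhd> G \<Longrightarrow> dser G db R \<subseteq> wsub G b (\<lambda>_. R)" by blast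
  have "dser G (Suc (max da db)) R \<subseteq> wsub G (Comm a b) (\<lambda>_. R)" if R: "R \<lhd> G" for R
  proof -
    have "dser G (max da db) R \<subseteq> wsub G a (\<lambda>_. R)" "dser G (max da db) R \<subseteq> wsub G b (\<lambda>_. R)"
      using da[OF R] db[OF R] dser_antimono[OF R, of da "max da db"]
        dser_antimono[OF R, of db "max da db"] by auto
    then show ?thesis by (simp add: comm_sub_mono)
  qed
  then show ?case by blast
qed

text \<open>If \<open>c\<close> has a variable outside \<open>S\<close>, its own hypothesis is used
  with a residual. Otherwise \<open>c\<close> is a maximal subword with variables in
  \<open>S\<close>, and the hypothesis for its sibling \<open>d\<close> is used.\<close>

lemma deep_leaf_absorbed_side_exists:
  assumes oc: "outer_commutator_word c" and od: "outer_commutator_word d"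
    and nN: "\<And>t. t \<in> cvars c \<union> cvars d \<Longrightarrow> N t \<lhd> G"
    and R: "R \<lhd> G" "\<And>t. t \<in> (cvars c \<union> cvars d) \<inter> S \<Longrightarrow> R \<subseteq> N t"
    and IHc: "\<not> cvars c \<subseteq> S \<Longrightarrow> \<exists>D. deep_leaf_absorbed G N S R D c"
    and IHd: "\<not> cvars d \<subseteq> S \<Longrightarrow> \<exists>D. deep_leaf_absorbed G N S R D d"
    and nS: "\<not> (cvars c \<subseteq> S \<and> cvars d \<subseteq> S)"
  shows "\<exists>D. deep_leaf_absorbed_side G N S R D c d"
proof -
  have nc: "wsub G c N \<lhd> G" and nd: "wsub G d N \<lhd> G"
    using nN by (auto intro!: wsub_normal)
  have nNR: "N s \<inter> R \<lhd> G" if "s \<in> cvars c \<union> cvars d" for s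
    using normal_subgroup_intersect nN[OF that] R(1) by blast
  show ?thesis
  proof (cases "cvars c \<subseteq> S")
    case False
    then obtain D where D: "deep_leaf_absorbed G N S R D c" using IHc by blast
    show ?thesis
      unfolding deep_leaf_absorbed_side_def
    proof (intro exI[of _ D] allI impI ballI)
      fix E t assume E: "E \<lhd> G" and t: "t \<in> cvars c \<inter> S"
        and sub: "\<forall>s\<in>cvars c - S. comm_sub G (wsub G c (N(s := N s \<inter> R))) (wsub G d N) \<subseteq> E"
      have sg: "subgroup E G" using E normal_imp_subgroup by blast
      have nr: "resid G E (wsub G d N) \<lhd> G"
        using resid_normal E nd normal_conj_closed by blast
      have "wsub G c (N(s := N s \<inter> R)) \<subseteq> resid G E (wsub G d N)" if s: "s \<in> cvars c - S" for s
      proof -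
        have "wsub G c (N(s := N s \<inter> R)) \<lhd> G"
          using nN nNR s by (auto intro!: wsub_normal)
        then show ?thesis
          using sub s comm_sub_subset_iff_resid[OF sg normal_subset_carrier] by blast
      qed
      then have "wsub G c (N(t := dser G D R)) \<subseteq> resid G E (wsub G d N)"
        using D nr t unfolding deep_leaf_absorbed_def by blast
      moreover have "wsub G c (N(t := dser G D R)) \<lhd> G"
        using nN dser_normal[OF R(1)] by (auto intro!: wsub_normal)
      ultimately show "comm_sub G (wsub G c (N(t := dser G D R))) (wsub G d N) \<subseteq> E"
        using comm_sub_subset_iff_resid[OF sg normal_subset_carrier] by blast
    qed
  next
    case True
    then obtain D where D: "deep_leaf_absorbed G N S R D d" using nS IHd by blast
    obtain h where h: "\<And>R. R \<lhd> G \<Longrightarrow> dser G h R \<subseteq> wsub G c (\<lambda>_. R)"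
      using dser_subset_wsub[of c] by blast
    \<comment> \<open>Starting at depth \<open>D\<close> instead of \<open>R\<close> itself makes
      the leaves of \<open>d\<close> in \<open>S\<close> deep enough for \<open>D\<close>.\<close>
    define A where "A = wsub G c (\<lambda>_. dser G D R)"
    have nX: "dser G D R \<lhd> G" using dser_normal R(1) by blast
    have nA: "A \<lhd> G" unfolding A_def using nX by (intro wsub_normal)
    have ne: "cvars c \<noteq> {}" by (induction c) auto
    then have AX: "A \<subseteq> dser G D R"
      unfolding A_def using wsub_subset_leaf[of c "\<lambda>_. dser G D R"] nX by blast
    then have AR: "A \<subseteq> R" using dser_subset[OF R(1)] by blast
    have Ac: "A \<subseteq> wsub G c N"
      unfolding A_def using True R dser_subset[OF R(1)] by (intro wsub_mono) blast
    \<comment> \<open>\<open>D\<close> is the depth for \<open>d\<close>, \<open>h\<close> leads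
      from there into \<open>A\<close>, and 1 is for the commutator [A, A].\<close>
    have "dser G (D + h + 1) R = comm_sub G (dser G h (dser G D R)) (dser G h (dser G D R))"
      by (simp add: dser_add)
    also have "\<dots> \<subseteq> comm_sub G A A"
      unfolding A_def by (intro comm_sub_mono h nX)
    finally have deep: "dser G (D + h + 1) R \<subseteq> comm_sub G A A" .
    show ?thesis
      unfolding deep_leaf_absorbed_side_def
    proof (intro exI[of _ "D + h + 1"] allI impI ballI)
      fix E t assume E: "E \<lhd> G" and t: "t \<in> cvars c \<inter> S"
        and sub: "\<forall>s\<in>cvars d - S. comm_sub G (wsub G d (N(s := N s \<inter> R))) (wsub G c N) \<subseteq> E"
      have sg: "subgroup E G" using E normal_imp_subgroup by blast
      have nr: "resid G E A \<lhd> G"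
        using resid_normal E nA normal_conj_closed by blast
      have subR: "wsub G d (N(s := N s \<inter> R)) \<subseteq> resid G E A" if s: "s \<in> cvars d - S" for s
      proof -
        have "wsub G d (N(s := N s \<inter> R)) \<lhd> G"
          using nN nNR s by (auto intro!: wsub_normal)
        moreover have "comm_sub G (wsub G d (N(s := N s \<inter> R))) A \<subseteq> E"
          using comm_sub_mono[OF subset_refl Ac] sub s by blast
        ultimately show ?thesis
          using comm_sub_subset_iff_resid[OF sg normal_subset_carrier] by blast
      qed
      have subX: "wsub G d (N(s := dser G D R)) \<subseteq> resid G E A" if "s \<in> cvars d \<inter> S" for s
        using D nr subR that unfolding deep_leaf_absorbed_def by blast
      have dA: "comm_sub G (wsub G d N) A \<subseteq> resid G E A"
      proof (rule comm_wsub_subset[OF od _ nA nr])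
        show "N s \<lhd> G" if "s \<in> cvars d" for s using nN that by blast
        fix s assume s: "s \<in> cvars d"
        \<comment> \<open>So [N_s, A] lies in \<open>dser G D R\<close>, as needed for
          \<open>s\<close> in \<open>S\<close>, and in \<open>N s \<inter> R\<close>, as needed for
          \<open>s\<close> outside \<open>S\<close>.\<close>
        have l: "comm_sub G (N s) A \<subseteq> N s" and r: "comm_sub G (N s) A \<subseteq> A"
          using comm_sub_subset_left comm_sub_subset_right nN s nA by blast+
        show "wsub G d (N(s := comm_sub G (N s) A)) \<subseteq> resid G E A"
        proof (cases "s \<in> S")
          case True
          have "wsub G d (N(s := comm_sub G (N s) A)) \<subseteq> wsub G d (N(s := dser G D R))"
            using r AX by (intro wsub_mono) auto
          then show ?thesis using subX s True by blast
        next
          case False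
          have "wsub G d (N(s := comm_sub G (N s) A)) \<subseteq> wsub G d (N(s := N s \<inter> R))"
            using l r AR by (intro wsub_mono) auto
          then show ?thesis using subR s False by blast
        qed
      qed
      have ndA: "comm_sub G (wsub G d N) A \<lhd> G" using comm_sub_normal nd nA by blast
      have "comm_sub G (comm_sub G (wsub G d N) A) A \<subseteq> E"
        using dA comm_sub_subset_iff_resid[OF sg normal_subset_carrier[OF ndA]] by blast
      then have AAd: "comm_sub G (comm_sub G A A) (wsub G d N) \<subseteq> E"
        using three_subgroups[OF nA nA nd E] comm_sub_commute[OF nA nd] by simp
      have "wsub G c (N(t := dser G (D + h + 1) R)) \<subseteq> dser G (D + h + 1) R"
        using wsub_upd_subset[OF _ _ dser_normal[OF R(1)]] nN t by blast
      then have "comm_sub G (wsub G c (N(t := dser G (D + h + 1) R))) (wsub G d N)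
          \<subseteq> comm_sub G (comm_sub G A A) (wsub G d N)"
        using deep by (intro comm_sub_mono) auto
      then show "comm_sub G (wsub G c (N(t := dser G (D + h + 1) R))) (wsub G d N) \<subseteq> E"
        using AAd by blast
    qed
  qed
qed

text \<open>A single variable outside \<open>S\<close> leaves nothing to show. A commutator uses the
  side lemma in both orders, and the larger depth serves both because the derived series
  descends.\<close>

lemma deep_leaf_absorbed_exists:
  assumes "outer_commutator_word v" "\<And>t. t \<in> cvars v \<Longrightarrow> N t \<lhd> G" "R \<lhd> G"
    "\<And>t. t \<in> cvars v \<inter> S \<Longrightarrow> R \<subseteq> N t" "\<not> cvars v \<subseteq> S"
  shows "\<exists>D. deep_leaf_absorbed G N S R D v"
  using assms
proof (induction v)
  case (Var i)
  then show ?case by (auto simp: deep_leaf_absorbed_def)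
next
  case (Comm a b)
  have disj: "cvars a \<inter> cvars b = {}" and o: "outer_commutator_word a" "outer_commutator_word b"
    using Comm.prems by auto
  have R: "R \<lhd> G" by fact
  have nN: "N t \<lhd> G" if "t \<in> cvars a \<union> cvars b" for t
    using Comm.prems(2) that by simp
  have na: "wsub G a N \<lhd> G" and nb: "wsub G b N \<lhd> G"
    using nN by (auto intro!: wsub_normal)
  have IHa: "\<exists>D. deep_leaf_absorbed G N S R D a" if "\<not> cvars a \<subseteq> S"
    using Comm.IH(1)[OF o(1)] Comm.prems that by simp
  have IHb: "\<exists>D. deep_leaf_absorbed G N S R D b" if "\<not> cvars b \<subseteq> S"
    using Comm.IH(2)[OF o(2)] Comm.prems that by simp
  have RN: "R \<subseteq> N t" if "t \<in> (cvars a \<union> cvars b) \<inter> S" for t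
    using Comm.prems(4) that by simp
  have nS: "\<not> (cvars a \<subseteq> S \<and> cvars b \<subseteq> S)" using Comm.prems(5) by simp
  have "\<exists>D. deep_leaf_absorbed_side G N S R D a b"
    by (rule deep_leaf_absorbed_side_exists) (use o nN R RN IHa IHb nS in auto)
  then obtain Da where Da: "deep_leaf_absorbed_side G N S R Da a b" ..
  have "\<exists>D. deep_leaf_absorbed_side G N S R D b a"
    by (rule deep_leaf_absorbed_side_exists) (use o nN R RN IHa IHb nS in auto)
  then obtain Db where Db: "deep_leaf_absorbed_side G N S R Db b a" ..
  have wa: "wsub G (Comm a b) (N(t := Y)) = comm_sub G (wsub G a (N(t := Y))) (wsub G b N)"
    if "t \<in> cvars a" for t Y
  proof -
    have "t \<notin> cvars b" using that disj by blast
    then show ?thesis by (simp add: wsub_upd_other del: fun_upd_apply)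
  qed
  have wb: "wsub G (Comm a b) (N(t := Y)) = comm_sub G (wsub G b (N(t := Y))) (wsub G a N)"
    if "t \<in> cvars b" "Y \<lhd> G" for t Y
  proof -
    have "t \<notin> cvars a" using that disj by blast
    moreover have "wsub G b (N(t := Y)) \<lhd> G" using nN that by (auto intro!: wsub_normal)
    ultimately show ?thesis
      using comm_sub_commute[OF na] by (simp add: wsub_upd_other del: fun_upd_apply)
  qed
  have "deep_leaf_absorbed G N S R (max Da Db) (Comm a b)"
    unfolding deep_leaf_absorbed_def
  proof (intro allI impI ballI)
    fix E t assume E: "E \<lhd> G" and t: "t \<in> cvars (Comm a b) \<inter> S"
      and sub: "\<forall>s\<in>cvars (Comm a b) - S. wsub G (Comm a b) (N(s := N s \<inter> R)) \<subseteq> E"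
    have sub_a: "\<forall>s\<in>cvars a - S. comm_sub G (wsub G a (N(s := N s \<inter> R))) (wsub G b N) \<subseteq> E"
    proof
      fix s assume s: "s \<in> cvars a - S"
      then have "wsub G (Comm a b) (N(s := N s \<inter> R)) \<subseteq> E" using sub by fastforce
      then show "comm_sub G (wsub G a (N(s := N s \<inter> R))) (wsub G b N) \<subseteq> E"
        using wa[of s "N s \<inter> R"] s by blast
    qed
    have sub_b: "\<forall>s\<in>cvars b - S. comm_sub G (wsub G b (N(s := N s \<inter> R))) (wsub G a N) \<subseteq> E"
    proof
      fix s assume s: "s \<in> cvars b - S"
      then have "N s \<inter> R \<lhd> G" using normal_subgroup_intersect nN R by blast
      moreover have "wsub G (Comm a b) (N(s := N s \<inter> R)) \<subseteq> E" using sub s by fastforce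
      ultimately show "comm_sub G (wsub G b (N(s := N s \<inter> R))) (wsub G a N) \<subseteq> E"
        using wb[of s "N s \<inter> R"] s by blast
    qed
    have anti: "wsub G (Comm a b) (N(t := dser G (max Da Db) R)) \<subseteq> wsub G (Comm a b) (N(t := dser G d R))"
      if "d \<le> max Da Db" for d
      using dser_antimono[OF R that] by (intro wsub_mono) auto
    show "wsub G (Comm a b) (N(t := dser G (max Da Db) R)) \<subseteq> E"
    proof (cases "t \<in> cvars a")
      case True
      then have "wsub G (Comm a b) (N(t := dser G Da R)) \<subseteq> E"
        unfolding wa[OF True] using Da E sub_a sub_b t True by (simp add: deep_leaf_absorbed_side_def)
      then show ?thesis using anti[of Da] by simp
    next
      case False
      then have tb: "t \<in> cvars b" using t by simp
      then have "wsub G (Comm a b) (N(t := dser G Db R)) \<subseteq> E"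
        unfolding wb[OF tb dser_normal[OF R]] using Db E sub_b sub_a t tb
        by (simp add: deep_leaf_absorbed_side_def)
      then show ?thesis using anti[of Db] by simp
    qed
  qed
  then show ?case by blast
qed

text \<open>The downward induction step. First comes a depth \<open>D\<close> at which the derived
  subgroup of \<open>R\<close> gives a finite result in every leaf of \<open>S\<close>;
  linearisation then brings the depth back to 0.\<close>

lemma finite_wsub_step:
  assumes o: "outer_commutator_word w" and nN: "\<And>t. t \<in> cvars w \<Longrightarrow> N t \<lhd> G"
    and fin: "finite (word_values G w N)"
    and S: "S \<subseteq> cvars w" and R: "R \<lhd> G" "\<And>t. t \<in> S \<Longrightarrow> R \<subseteq> N t"
    and IH: "\<And>s. s \<in> cvars w - S \<Longrightarrow> finite (wsub G w (N(s := N s \<inter> R)))"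
    and t: "t \<in> S"
  shows "finite (wsub G w (N(t := R)))"
proof -
  have finS: "finite S" using S finite_cvars finite_subset by blast
  have nNR: "N s \<inter> R \<lhd> G" if "s \<in> cvars w" for s
    using normal_subgroup_intersect nN[OF that] R(1) by blast
  obtain D where D: "\<And>t. t \<in> S \<Longrightarrow> finite (wsub G w (N(t := dser G D R)))"
  proof (cases "cvars w \<subseteq> S")
    case True
    \<comment> \<open>Now \<open>R\<close> lies in every leaf subgroup, so w(N) contains a derived
      subgroup of \<open>R\<close>, and the next one lies in the finite derived subgroup of
      w(N).\<close>
    obtain d where d: "dser G d R \<subseteq> wsub G w (\<lambda>_. R)"
      using dser_subset_wsub[of w] R(1) by blast
    also have "wsub G w (\<lambda>_. R) \<subseteq> wsub G w N"
      using True R(2) by (intro wsub_mono) blast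
    also have "wsub G w N = generate G (word_values G w N)"
      using wsub_eq_generate[OF o nN] by simp
    finally have "dser G (Suc d) R \<subseteq> comm_sub G (generate G (word_values G w N)) (generate G (word_values G w N))"
      by (simp add: comm_sub_mono)
    moreover have "finite (comm_sub G (generate G (word_values G w N)) (generate G (word_values G w N)))"
      using nN by (intro finite_commutator_subgroup[OF fin] word_values_conj_closed normal_conj_closed) auto
    ultimately have "finite (dser G (Suc d) R)" using finite_subset by blast
    moreover have "wsub G w (N(t := dser G (Suc d) R)) \<subseteq> dser G (Suc d) R" if "t \<in> S" for t
      by (rule wsub_upd_subset[OF _ _ dser_normal[OF R(1)]]) (use nN that S in auto)
    ultimately show ?thesis using that finite_subset by blast
  next
    case False
    have "\<exists>D. deep_leaf_absorbed G N S R D w"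
      by (rule deep_leaf_absorbed_exists) (use o nN R False in auto)
    then obtain D where D: "deep_leaf_absorbed G N S R D w" ..
    have "finite (cvars w - S)" using finite_cvars by blast
    then obtain E where E: "E \<lhd> G" "finite E"
      and sub: "\<And>s. s \<in> cvars w - S \<Longrightarrow> wsub G w (N(s := N s \<inter> R)) \<subseteq> E"
    proof (rule finite_normal_join[where K = "\<lambda>s. wsub G w (N(s := N s \<inter> R))"])
      show "wsub G w (N(s := N s \<inter> R)) \<lhd> G" if "s \<in> cvars w - S" for s
        using nN nNR that by (auto intro!: wsub_normal)
    qed (use IH in auto)
    have "wsub G w (N(t := dser G D R)) \<subseteq> E" if "t \<in> S" for t
      using D E(1) sub that S unfolding deep_leaf_absorbed_def by blast
    then show ?thesis using that E(2) finite_subset by blast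
  qed
  txt \<open>
    At level \<open>0\<close> the leaf carries \<open>N\<^sub>t\<close>, at level \<open>l + 1\<close> the \<open>l\<close>-th derived subgroup of \<open>R\<close>.
    Linearising in a leaf of maximal level makes every error term raise the level of some leaf.
  \<close>
  define lev where "lev \<delta> t = (if t \<in> S \<and> \<delta> t > 0 then dser G (\<delta> t - 1) R else N t)"
    for \<delta> :: "nat \<Rightarrow> nat" and t
  have lev_normal: "lev \<delta> s \<lhd> G" if "s \<in> cvars w" for \<delta> s
    using that nN dser_normal[OF R(1)] by (simp add: lev_def)
  have lev_N: "lev \<delta> s \<subseteq> N s" for \<delta> s
    using order_trans[OF dser_subset[OF R(1)] R(2)] by (simp add: lev_def)
  have "finite (wsub G w (lev \<delta>))" if "t \<in> S" "\<delta> t > 0" for \<delta> t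
    using that
  \<comment> \<open>The measure is the total shortfall below level \<open>D + 1\<close>, where a
    leaf carries \<open>dser G D R\<close>; truncated subtraction counts higher levels as 0.\<close>
  proof (induction "\<Sum>s\<in>S. Suc D - \<delta> s" arbitrary: \<delta> t rule: less_induct)
    case less
    show ?case
    proof (cases "\<exists>s\<in>S. D < \<delta> s")
      case True
      then obtain s where s: "s \<in> S" "D < \<delta> s" by blast
      have "lev \<delta> r \<subseteq> (N(s := dser G D R)) r" for r
        using lev_N[of \<delta> r] s dser_antimono[OF R(1), of D "\<delta> s - 1"] by (auto simp: lev_def)
      then have "wsub G w (lev \<delta>) \<subseteq> wsub G w (N(s := dser G D R))"
        by (intro wsub_mono)
      then show ?thesis using D[OF s(1)] finite_subset by blast
    next
      case False
      have "Max (\<delta> ` S) \<in> \<delta> ` S" using finS less.prems(1) by (intro Max_in) auto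
      then obtain i where i0: "i \<in> S" "\<delta> i = Max (\<delta> ` S)" by auto
      then have i: "i \<in> S" "\<And>s. s \<in> S \<Longrightarrow> \<delta> s \<le> \<delta> i" using finS by auto
      have ipos: "\<delta> i > 0" using i(2)[OF less.prems(1)] less.prems(2) by linarith
      have li: "lev \<delta> i = dser G (\<delta> i - 1) R" using i ipos by (simp add: lev_def)
      have iw: "i \<in> cvars w" using i S by blast
      show ?thesis
      proof (rule finite_wsub_linear[OF o iw])
        show "lev \<delta> s \<lhd> G" if "s \<in> cvars w" for s by (rule lev_normal[OF that])
        show "finite (word_values G w (lev \<delta>))"
          by (rule finite_subset[OF word_values_mono fin]) (rule lev_N)
        fix s assume s: "s \<in> cvars w" "s \<noteq> i"
        define C where "C = comm_sub G (lev \<delta> s) (lev \<delta> i)"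
        have Cs: "C \<subseteq> lev \<delta> s" and Ci: "C \<subseteq> lev \<delta> i"
          unfolding C_def
          using comm_sub_subset_left[OF lev_normal[OF s(1)] lev_normal[OF iw]]
            comm_sub_subset_right[OF lev_normal[OF s(1)] lev_normal[OF iw]] by simp_all
        show "finite (wsub G w ((lev \<delta>)(s := comm_sub G (lev \<delta> s) (lev \<delta> i))))"
          unfolding C_def[symmetric]
        proof (cases "s \<in> S")
          case False
          have "C \<subseteq> N s \<inter> R"
            using Cs Ci lev_N[of \<delta> s] li dser_subset[OF R(1)] by blast
          then have "wsub G w ((lev \<delta>)(s := C)) \<subseteq> wsub G w (N(s := N s \<inter> R))"
            using lev_N by (intro wsub_mono) auto
          then show "finite (wsub G w ((lev \<delta>)(s := C)))"
            using IH s False finite_subset by blast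
        next
          case True
          \<comment> \<open>Equal levels produce the next derived subgroup, hence one level more.
            For a lower level of \<open>s\<close>, \<open>C\<close> still lies in the leaf subgroup
            of \<open>i\<close>, so level \<open>\<delta> i\<close> is reached.\<close>
          define n where "n = (if \<delta> s = \<delta> i then Suc (\<delta> i) else \<delta> i)"
          have n: "\<delta> s < n" "n > 0" using i(2)[OF True] ipos by (auto simp: n_def)
          have Cn: "C \<subseteq> dser G (n - 1) R"
          proof (cases "\<delta> s = \<delta> i")
            case eq: True
            then have ls: "lev \<delta> s = lev \<delta> i" using True i ipos by (simp add: lev_def)
            obtain j where "\<delta> i = Suc j" using ipos gr0_implies_Suc by blast
            then show ?thesis using eq by (simp add: C_def ls li n_def)
          next
            case False
            then show ?thesis using Ci li by (simp add: n_def)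
          qed
          have "wsub G w ((lev \<delta>)(s := C)) \<subseteq> wsub G w (lev (\<delta>(s := n)))"
            using Cn True n by (intro wsub_mono) (auto simp: lev_def)
          moreover have "(\<Sum>r\<in>S. Suc D - (\<delta>(s := n)) r) < (\<Sum>r\<in>S. Suc D - \<delta> r)"
          proof (rule sum_strict_mono_ex1[OF finS])
            show "\<forall>r\<in>S. Suc D - (\<delta>(s := n)) r \<le> Suc D - \<delta> r" using n by auto
            have "\<delta> s \<le> D" using True \<open>\<not> (\<exists>s\<in>S. D < \<delta> s)\<close> by auto
            then show "\<exists>r\<in>S. Suc D - (\<delta>(s := n)) r < Suc D - \<delta> r"
              using True n by (intro bexI[of _ s]) auto
          qed
          then have "finite (wsub G w (lev (\<delta>(s := n))))"
            using less.hyps[of "\<delta>(s := n)" s] True n by simp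
          ultimately show "finite (wsub G w ((lev \<delta>)(s := C)))" using finite_subset by blast
        qed
      qed
    qed
  qed
  \<comment> \<open>Level 1 at \<open>t\<close> carries \<open>dser G 0 R\<close>, which is
    \<open>R\<close>, and level 0 leaves \<open>N\<close> unchanged.\<close>
  from this[OF t, of "\<lambda>s. if s = t then 1 else 0"]
  have "finite (wsub G w (lev (\<lambda>s. if s = t then 1 else 0)))" by simp
  moreover have "wsub G w (lev (\<lambda>s. if s = t then 1 else 0)) = wsub G w (N(t := R))"
    using t by (intro wsub_cong) (auto simp: lev_def)
  ultimately show ?thesis by simp
qed

text \<open>Downward induction on \<open>S\<close>: the tuple for \<open>insert s S\<close> has at
  \<open>s\<close> the intersection of \<open>N s\<close> with the one over \<open>S\<close>, as
  \<open>finite_wsub_step\<close> requires. For a singleton the tuple is \<open>N\<close>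
  itself.\<close>

lemma finite_wsub:
  assumes o: "outer_commutator_word w" and nN: "\<And>t. t \<in> cvars w \<Longrightarrow> N t \<lhd> G"
    and fin: "finite (word_values G w N)"
  shows "finite (wsub G w N)"
proof -
  have main: "finite (wsub G w (N(t := (\<Inter>s\<in>S. N s))))" if "S \<subseteq> cvars w" "t \<in> S" for S t
    using that
  proof (induction "card (cvars w - S)" arbitrary: S t rule: less_induct)
    case less
    have finS: "finite S" using less.prems(1) finite_cvars finite_subset by blast
    have "(\<Inter>s\<in>S. N s) \<lhd> G"
      using finS less.prems
    proof (induction S arbitrary: t rule: finite_induct)
      case (insert x F)
      show ?case
      proof (cases "F = {}")
        case True
        then show ?thesis using insert.prems nN by simp
      next
        case False
        then have "(\<Inter>s\<in>F. N s) \<lhd> G" using insert by blast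
        then show ?thesis using insert.prems nN normal_subgroup_intersect by simp
      qed
    qed simp
    moreover have "finite (wsub G w (N(s := N s \<inter> (\<Inter>s\<in>S. N s))))" if s: "s \<in> cvars w - S" for s
    proof -
      have "card (cvars w - insert s S) < card (cvars w - S)"
        using s finite_cvars[of w] by (intro psubset_card_mono) auto
      then have "finite (wsub G w (N(s := (\<Inter>s\<in>insert s S. N s))))"
        using less.hyps[of "insert s S" s] s less.prems by simp
      then show ?thesis by simp
    qed
    ultimately show ?case
      using finite_wsub_step[OF o nN fin less.prems(1), of "\<Inter>s\<in>S. N s" t] less.prems(2) by blast
  qed
  have "cvars w \<noteq> {}" by (induction w) auto
  then obtain t where "t \<in> cvars w" by blast
  then show ?thesis using main[of "{t}" t] by simp
qed

end

theorem theoremB: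
  fixes G :: "('a, 'b) monoid_scheme"
    and w :: cword
    and N :: "nat \<Rightarrow> 'a set"
  assumes "group G"
    and "outer_commutator_word w"
    and "\<And>i. i \<in> cvars w \<Longrightarrow> N i \<lhd> G"
    and "finite (word_values G w N)"
  shows "finite (word_subgroup G w N)"
  using group.finite_wsub[OF assms] group.wsub_eq_generate[OF assms(1-3)]
  by (simp add: word_subgroup_def)

end
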